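(* Suppose that the following regularity assumption holds: there exists a set $\mathcal{V}\subset\operatorname{lsc-fcns}(\mathcal{X})$ with $0\in\mathcal{V}$ such that for each $V\in\mathcal{V}$ and $x\in\mathcal{X}$ the function $b(V)(x,\cdot)$ is integrable with respect to $\mathbb{P}$ and $B$ maps $\mathcal{V}$ into itself, and, moreover, for each $\nu\in\mathbb{N}$, for each $V\in\mathcal{V}$ and $x\in\mathcal{X}$ the function $b_\nu(V)(x,\cdot)$ is integrable with respect to $\mathbb{P}_\nu$ and $B_\nu$ maps $\mathcal{V}$ into itself. Suppose that $\mathbb{P}_\nu\Rightarrow\mathbb{P}$ (weak convergence), $\varphi_\nu\overset{\mathrm{e}}{\to}\varphi$, and $\varphi_\nu\overset{\mathrm{p}}{\to}\varphi$. Let $\{V^t\}_{t=1}^{T+1}$ be given by $V^{T+1}=0$, $V^t=B(V^{t+1})$ for $t\in\{1,\ldots,T\}$, and for each $\nu$ let $\{V_\nu^t\}_{t=1}^{T+1}$ be given by $V_\nu^{T+1}=0$, $V_\nu^t=B_\nu(V_\nu^{t+1})$ for $t\in\{1,\ldots,T\}$ (these are real-valued functions on $\mathcal{X}$). Suppose that for each $t\in\{1,\ldots,T\}$ the sequence $\{V_\nu^{t+1}\}_{\nu\in\mathbb{N}}$ is equi-lsc and satisfies the following conditions for each $\bar x\in\mathcal{X}$: (i) One has $$\liminf_{\tau\to-\infty}\ \liminf_{(\nu,x)\to(\infty,\bar x)}\ \mathbb{E}_{\mathbb{P}_\nu}\Bigl[b_\nu(V_\nu^{t+1})(x,\boldsymbol{\xi})\,\mathbb{1}\bigl\{b_\nu(V_\nu^{t+1})(x,\boldsymbol{\xi})\le\tau\bigr\}\Bigr]=0,$$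 and $\{b_\nu(V_\nu^{t+1})\}_{\nu\in\mathbb{N}}$ is a sequence of lsc functions on $\mathcal{X}\times\Xi$ that is equi-lsc. (ii) One has $$\limsup_{\tau\to\infty}\ \limsup_{\nu\to\infty}\ \mathbb{E}_{\mathbb{P}_\nu}\Bigl[b_\nu(V_\nu^{t+1})(\bar x,\boldsymbol{\xi})\,\mathbb{1}\bigl\{b_\nu(V_\nu^{t+1})(\bar x,\boldsymbol{\xi})\ge\tau\bigr\}\Bigr]=0,$$ and $\{b_\nu(V_\nu^{t+1})(\bar x,\cdot)\}_{\nu\in\mathbb{N}}$ is a sequence of usc functions on $\Xi$ that is equi-usc. Then for each $t\in\{1,\ldots,T\}$ it holds that $V_\nu^{t+1}\overset{\mathrm{e}}{\to}V^{t+1}$ and, for all $(x,\xi)\in\mathcal{X}\times\Xi$, $$\operatorname{LimOut}\Bigl(\operatorname*{argmin}_{y\in\mathcal{Y}(x,\xi)}\bigl\{\varphi_\nu(x,y,\xi)+\beta V_\nu^{t+1}(y)\bigr\}\Bigr)\subset\operatorname*{argmin}_{y\in\mathcal{Y}(x,\xi)}\bigl\{\varphi(x,y,\xi)+\beta V^{t+1}(y)\bigr\}\neq\varnothing .$$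
   Context: Setting. $\mathcal{X}\subset\mathbb{R}^n$ (state space) and $\Xi\subset\mathbb{R}^m$ (outcome space) are closed sets; $T\in\mathbb{N}$ is a finite horizon; $\beta\in(0,1)$; $\mathcal{Y}:\mathcal{X}\times\Xi\rightrightarrows\mathcal{X}$ is a set-valued mapping with nonempty compact values; $\varphi,\varphi_\nu:\mathcal{X}\times\mathcal{X}\times\Xi\to\mathbb{R}$ ($\nu\in\mathbb{N}$) are functions; $\mathbb{P},\mathbb{P}_\nu$ ($\nu\in\mathbb{N}$) are Borel probability distributions on $\Xi$. $\mathbb{E}_{\mathbb{P}}[f(\boldsymbol{\xi})]=\int_\Xi f(\xi)\,d\mathbb{P}(\xi)$, and $\mathbb{1}\{\mathcal{E}\}$ is $1$ if $\mathcal{E}$ is true and $0$ otherwise. Function classes. For a closed set $\mathcal{Z}\subset\mathbb{R}^r$, $\operatorname{fcns}(\mathcal{Z})$ is the set of functions $\mathcal{Z}\to[-\infty,\infty]$ other than the constant function $\infty$, and $\operatorname{lsc-fcns}(\mathcal{Z})$ is its subset of lower semicontinuous (lsc) functions; usc means upper semicontinuous. Bellman operators. For $f\in\operatorname{lsc-fcns}(\mathcal{X})$, $$b(f)(x,\xi)=\inf_{y\in\mathcal{Y}(x,\xi)}\{\varphi(x,y,\xi)+\beta f(y)\},\qquad B(f)(x)=\mathbb{E}_{\mathbb{P}}[b(f)(x,\boldsymbol{\xi})],$$ $$b_\nu(f)(x,\xi)=\inf_{y\in\mathcal{Y}(x,\xi)}\{\varphi_\nu(x,y,\xi)+\beta f(y)\},\qquad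 B_\nu(f)(x)=\mathbb{E}_{\mathbb{P}_\nu}[b_\nu(f)(x,\boldsymbol{\xi})].$$ Convergence. For $f,f_\nu\in\operatorname{fcns}(\mathcal{Z})$: $f_\nu\overset{\mathrm{p}}{\to}f$ means pointwise convergence; $f_\nu\overset{\mathrm{e}}{\to}f$ (epi-convergence) means that for each $z\in\mathcal{Z}$, every sequence $z_\nu\in\mathcal{Z}\to z$ satisfies $\liminf f_\nu(z_\nu)\ge f(z)$, and some sequence $z_\nu\in\mathcal{Z}\to z$ satisfies $\limsup f_\nu(z_\nu)\le f(z)$. Equi-semicontinuity. A sequence $f_\nu\in\operatorname{lsc-fcns}(\mathcal{Z})$ is equi-lsc if for every $\bar z\in\mathcal{Z}$ either $f_\nu(\bar z)\to-\infty$, or for each $\rho,\varepsilon\in(0,\infty)$ there exist $\bar\nu\in\mathbb{N}$ and $\delta>0$ such that $\inf_{z\in\mathcal{Z},\|z-\bar z\|_2\le\delta}f_\nu(z)\ge\min\{f_\nu(\bar z)-\varepsilon,\rho\}$ for all $\nu\ge\bar\nu$. A sequence of usc functions $f_\nu$ is equi-usc if $\{-f_\nu\}$ is equi-lsc. The limit $(\nu,x)\to(\infty,\bar x)$ means $\nu\to\infty$ in $\mathbb{N}$ and $x\to\bar x$ with $x\in\mathcal{X}$. For sets $S_\nu$, $\operatorname{LimOut}(S_\nu)$ (outer limit as $\nu\to\infty$) is the set of all points $z$ for which there are a subsequence $\nu_1<\nu_2<\cdots$ and $z_\kappa\in S_{\nu_\kappa}$ with $z_\kappa\to z$. *)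

theory Defs
  imports "HOL-Probability.Probability"
begin

(* A function on a set Z is an element of extensional Z (value undefined outside Z), so
   that equality and set membership depend only on the values on Z. *)

definition lsc_on :: "'a::topological_space set \<Rightarrow> ('a \<Rightarrow> ereal) \<Rightarrow> bool" where
  "lsc_on Z f \<longleftrightarrow> (\<forall>z\<in>Z. f z \<le> Liminf (at z within Z) f)"

definition usc_on :: "'a::topological_space set \<Rightarrow> ('a \<Rightarrow> ereal) \<Rightarrow> bool" where
  "usc_on Z f \<longleftrightarrow> (\<forall>z\<in>Z. Limsup (at z within Z) f \<le> f z)"

definition fcns :: "'a set \<Rightarrow> ('a \<Rightarrow> ereal) set" where
  "fcns Z = {f \<in> extensional Z. \<exists>z\<in>Z. f z \<noteq> \<infinity>}"

definition lsc_fcns :: "'a::topological_space set \<Rightarrow> ('a \<Rightarrow> ereal) set" where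
  "lsc_fcns Z = {f \<in> fcns Z. lsc_on Z f}"

definition epi_conv ::
    "'a::topological_space set \<Rightarrow> (nat \<Rightarrow> 'a \<Rightarrow> ereal) \<Rightarrow> ('a \<Rightarrow> ereal) \<Rightarrow> bool" where
  "epi_conv Z f g \<longleftrightarrow> (\<forall>z\<in>Z.
     (\<forall>s. (\<forall>\<nu>. s \<nu> \<in> Z) \<and> s \<longlonglongrightarrow> z \<longrightarrow> liminf (\<lambda>\<nu>. f \<nu> (s \<nu>)) \<ge> g z) \<and>
     (\<exists>s. (\<forall>\<nu>. s \<nu> \<in> Z) \<and> s \<longlonglongrightarrow> z \<and> limsup (\<lambda>\<nu>. f \<nu> (s \<nu>)) \<le> g z))"

definition pointwise_conv ::
    "'a set \<Rightarrow> (nat \<Rightarrow> 'a \<Rightarrow> ereal) \<Rightarrow> ('a \<Rightarrow> ereal) \<Rightarrow> bool" where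
  "pointwise_conv Z f g \<longleftrightarrow> (\<forall>z\<in>Z. (\<lambda>\<nu>. f \<nu> z) \<longlonglongrightarrow> g z)"

definition equi_lsc ::
    "'a::real_normed_vector set \<Rightarrow> (nat \<Rightarrow> 'a \<Rightarrow> ereal) \<Rightarrow> bool" where
  "equi_lsc Z f \<longleftrightarrow> (\<forall>\<nu>. f \<nu> \<in> lsc_fcns Z) \<and>
     (\<forall>z0\<in>Z. (\<lambda>\<nu>. f \<nu> z0) \<longlonglongrightarrow> - \<infinity> \<or>
       (\<forall>\<rho>>0. \<forall>\<epsilon>>0. \<exists>\<nu>0. \<exists>\<delta>>0. \<forall>\<nu>\<ge>\<nu>0.
          (INF z\<in>{z \<in> Z. norm (z - z0) \<le> \<delta>}. f \<nu> z)
            \<ge> min (f \<nu> z0 - ereal \<epsilon>) (ereal \<rho>)))"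

definition equi_usc ::
    "'a::real_normed_vector set \<Rightarrow> (nat \<Rightarrow> 'a \<Rightarrow> ereal) \<Rightarrow> bool" where
  "equi_usc Z f \<longleftrightarrow> (\<forall>\<nu>. usc_on Z (f \<nu>)) \<and> equi_lsc Z (\<lambda>\<nu>. \<lambda>z\<in>Z. - f \<nu> z)"

definition LimOut :: "(nat \<Rightarrow> 'a::topological_space set) \<Rightarrow> 'a set" where
  "LimOut S = {z. \<exists>r s. strict_mono r \<and> (\<forall>k. s k \<in> S (r k)) \<and> s \<longlonglongrightarrow> z}"

definition argmin_on :: "'a set \<Rightarrow> ('a \<Rightarrow> ereal) \<Rightarrow> 'a set" where
  "argmin_on A f = {y. is_arg_min f (\<lambda>y. y \<in> A) y}"

definition borel_prob_on :: "'a::topological_space set \<Rightarrow> 'a measure \<Rightarrow> bool" where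
  "borel_prob_on Z M \<longleftrightarrow> prob_space M \<and> sets M = sets (restrict_space borel Z)"

definition weak_conv_on ::
    "'a::topological_space set \<Rightarrow> (nat \<Rightarrow> 'a measure) \<Rightarrow> 'a measure \<Rightarrow> bool" where
  "weak_conv_on Z Ms M \<longleftrightarrow> (\<forall>h :: 'a \<Rightarrow> real. continuous_on Z h \<and> bounded (h ` Z) \<longrightarrow>
     (\<lambda>\<nu>. integral\<^sup>L (Ms \<nu>) h) \<longlonglongrightarrow> integral\<^sup>L M h)"

(* The library's integrable and integral take values in Banach spaces; the following are
   their counterparts for functions with values in [-\<infinity>, \<infinity>]. *)

definition ereal_integrable :: "'a measure \<Rightarrow> ('a \<Rightarrow> ereal) \<Rightarrow> bool" where
  "ereal_integrable M f \<longleftrightarrow>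
     f \<in> borel_measurable M \<and> (\<integral>\<^sup>+ x. e2ennreal \<bar>f x\<bar> \<partial>M) < \<infinity>"

(* e2ennreal maps negative numbers to 0, so this is E(f+) - E(f-). *)
definition ereal_expectation :: "'a measure \<Rightarrow> ('a \<Rightarrow> ereal) \<Rightarrow> ereal" where
  "ereal_expectation M f =
     enn2ereal (\<integral>\<^sup>+ x. e2ennreal (f x) \<partial>M) - enn2ereal (\<integral>\<^sup>+ x. e2ennreal (- f x) \<partial>M)"

definition bellman_objective ::
    "('a \<times> 'a \<times> 'b \<Rightarrow> real) \<Rightarrow> real \<Rightarrow> ('a \<Rightarrow> ereal) \<Rightarrow> 'a \<Rightarrow> 'b \<Rightarrow> 'a \<Rightarrow> ereal" where
  "bellman_objective \<phi> \<beta> f x \<xi> y = ereal (\<phi> (x, y, \<xi>)) + ereal \<beta> * f y"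

definition bellman_b ::
    "'a set \<Rightarrow> 'b set \<Rightarrow> ('a \<times> 'b \<Rightarrow> 'a set) \<Rightarrow> real \<Rightarrow> ('a \<times> 'a \<times> 'b \<Rightarrow> real) \<Rightarrow>
     ('a \<Rightarrow> ereal) \<Rightarrow> 'a \<times> 'b \<Rightarrow> ereal" where
  "bellman_b X \<Xi> Y \<beta> \<phi> f =
     restrict (\<lambda>(x, \<xi>). INF y\<in>Y (x, \<xi>). bellman_objective \<phi> \<beta> f x \<xi> y) (X \<times> \<Xi>)"

definition bellman_B ::
    "'a set \<Rightarrow> 'b set \<Rightarrow> ('a \<times> 'b \<Rightarrow> 'a set) \<Rightarrow> real \<Rightarrow> ('a \<times> 'a \<times> 'b \<Rightarrow> real) \<Rightarrow> 'b measure \<Rightarrow>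
     ('a \<Rightarrow> ereal) \<Rightarrow> 'a \<Rightarrow> ereal" where
  "bellman_B X \<Xi> Y \<beta> \<phi> M f =
     (\<lambda>x\<in>X. ereal_expectation M (\<lambda>\<xi>. bellman_b X \<Xi> Y \<beta> \<phi> f (x, \<xi>)))"

end

theory Submission
  imports Defs
begin

text \<open>
  The theorem follows by backward induction over the stages. The invariant at stage \<open>t\<close> is that
  the value functions \<open>Vn \<nu> t\<close> converge to \<open>V t\<close> pointwise and that \<open>V t\<close>
  lies below their joint lower limit as \<open>\<nu> \<rightarrow> \<infinity>\<close> and the argument moves
  simultaneously; together these give epi-convergence. It also records that \<open>V t\<close> is finite and
  that all value functions belong to \<open>\<V>\<close>, so that their Bellman integrands are integrable. It holds
  trivially at the terminal stage.

  Suppose that it holds at stage \<open>t + 1\<close>. The objective functions that are minimised over the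
  compact set \<open>Y (x, \<xi>)\<close> then converge in the same two senses, so by compactness their infima
  converge, the limiting problem has a solution, and outer limits of argmins consist of solutions
  (\<open>bellman_b_limits\<close>). Hence the functions \<open>bn \<nu> (Vn \<nu> (t + 1))\<close> converge
  pointwise to \<open>b (V (t + 1))\<close>, and equi-semicontinuity upgrades this to one-sided convergence along
  arbitrary moving arguments (\<open>equi_lsc_imp_le_joint_liminf\<close>).

  It remains to pass to the limit in expectations whose integrands and measures both vary. This is the
  core of the argument, \<open>fatou_weak_conv\<close>: the integrands are replaced by bounded Lipschitz
  minorants common to all large \<open>\<nu>\<close>, to which weak convergence applies, and the tail
  conditions control the truncation error. Applied to the integrands along a moving state \<open>x\<close> it
  yields the joint lower limit at stage \<open>t\<close>; applied to their negatives at a fixed state it yields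
  the upper estimate, and with it pointwise convergence (\<open>expectation_limits\<close>).
\<close>

section \<open>Joint lower limits and epi-convergence\<close>

text \<open>The lower half of epi-convergence, quantified over sequences, is a statement about one lower
limit in which the index and the point vary together. Working with this limit turns extractions of
subsequences into neighbourhood arguments, and makes the sequential formulation an easy
consequence.\<close>

definition joint_filter :: "'a::topological_space set \<Rightarrow> 'a \<Rightarrow> (nat \<times> 'a) filter" where
  "joint_filter Z z = sequentially \<times>\<^sub>F inf (nhds z) (principal Z)"

definition joint_liminf ::
    "'a::topological_space set \<Rightarrow> (nat \<Rightarrow> 'a \<Rightarrow> ereal) \<Rightarrow> 'a \<Rightarrow> ereal" where
  "joint_liminf Z f z = Liminf (joint_filter Z z) (\<lambda>(\<nu>, y). f \<nu> y)"

lemma eventually_joint_filter: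
  "eventually (\<lambda>(\<nu>, y). P \<nu> y) (joint_filter Z z) \<longleftrightarrow>
     (\<exists>N U. open U \<and> z \<in> U \<and> (\<forall>\<nu>\<ge>N. \<forall>y\<in>U \<inter> Z. P \<nu> y))" (is "?L \<longleftrightarrow> ?R")
proof
  assume ?L
  then obtain A C where A: "eventually A sequentially"
    and C: "eventually C (inf (nhds z) (principal Z))"
    and P: "\<And>\<nu> y. A \<nu> \<Longrightarrow> C y \<Longrightarrow> P \<nu> y"
    unfolding joint_filter_def eventually_prod_filter by auto
  obtain N where N: "\<And>\<nu>. \<nu> \<ge> N \<Longrightarrow> A \<nu>" using A by (auto simp: eventually_sequentially)
  obtain U where U: "open U" "z \<in> U" "\<And>y. y \<in> U \<Longrightarrow> y \<in> Z \<Longrightarrow> C y"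
    using C by (auto simp: eventually_inf_principal eventually_nhds)
  show ?R using N U P by (intro exI[of _ N] exI[of _ U]) auto
next
  assume ?R
  then obtain N U where U: "open U" "z \<in> U" "\<forall>\<nu>\<ge>N. \<forall>y\<in>U \<inter> Z. P \<nu> y" by blast
  have "eventually (\<lambda>\<nu>. \<nu> \<ge> N) sequentially" by (rule eventually_ge_at_top)
  moreover have "eventually (\<lambda>y. y \<in> U \<inter> Z) (inf (nhds z) (principal Z))"
    using U by (auto simp: eventually_inf_principal eventually_nhds)
  ultimately show ?L
    unfolding joint_filter_def eventually_prod_filter using U(3) by fastforce
qed

lemma less_joint_liminfD:
  assumes "c < joint_liminf Z f z"
  obtains N U where "open U" "z \<in> U" "\<And>\<nu> y. \<nu> \<ge> N \<Longrightarrow> y \<in> U \<Longrightarrow> y \<in> Z \<Longrightarrow> c < f \<nu> y"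
proof -
  have "eventually (\<lambda>(\<nu>, y). c < f \<nu> y) (joint_filter Z z)"
    using less_LiminfD[OF assms[unfolded joint_liminf_def]]
    by (auto elim!: eventually_mono)
  then show thesis
    unfolding eventually_joint_filter using that by (metis IntI)
qed

lemma le_joint_liminfI:
  assumes "\<And>c. c < g \<Longrightarrow> \<exists>N U. open U \<and> z \<in> U \<and> (\<forall>\<nu>\<ge>N. \<forall>y\<in>U \<inter> Z. c \<le> f \<nu> y)"
  shows "g \<le> joint_liminf Z f z"
  unfolding joint_liminf_def le_Liminf_iff
proof (intro allI impI)
  fix c assume "c < g"
  then obtain d where d: "c < d" "d < g" using dense by blast
  show "eventually (\<lambda>p. c < (case p of (\<nu>, y) \<Rightarrow> f \<nu> y)) (joint_filter Z z)"
    using assms[OF d(2)] less_le_trans[OF d(1)]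
    unfolding case_prod_beta' prod.case_distrib[of "\<lambda>v. c < v"] eventually_joint_filter[of "\<lambda>\<nu> y. c < f \<nu> y" Z z, unfolded case_prod_beta']
    by meson
qed

lemma filterlim_joint_filter:
  assumes "filterlim r sequentially F" "eventually (\<lambda>k. s k \<in> Z) F" "(s \<longlongrightarrow> z) F"
  shows "filterlim (\<lambda>k. (r k, s k)) (joint_filter Z z) F"
  unfolding joint_filter_def
  by (intro filterlim_Pair assms) (use assms in \<open>auto simp: filterlim_inf filterlim_principal\<close>)

text \<open>With \<open>F = sequentially\<close> and \<open>r\<close> the identity this is the lower
inequality of epi-convergence; with a strictly monotone \<open>r\<close> it is its version for
subsequences, which is what outer limits of argmins require.\<close>

lemma joint_liminf_le_Liminf:
  assumes "filterlim r sequentially F" "eventually (\<lambda>k. s k \<in> Z) F" "(s \<longlongrightarrow> z) F"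
  shows "joint_liminf Z f z \<le> Liminf F (\<lambda>k. f (r k) (s k))"
  unfolding le_Liminf_iff
proof (intro allI impI)
  fix c assume "c < joint_liminf Z f z"
  then have "eventually (\<lambda>p. c < (case p of (\<nu>, y) \<Rightarrow> f \<nu> y)) (joint_filter Z z)"
    unfolding joint_liminf_def by (rule less_LiminfD)
  with filterlim_joint_filter[OF assms]
  show "eventually (\<lambda>k. c < f (r k) (s k)) F"
    unfolding filterlim_iff by fastforce
qed

lemma filterlim_fst_joint_filter: "filterlim fst sequentially (joint_filter Z z)"
  unfolding joint_filter_def by (rule filterlim_fst)

lemma tendsto_snd_joint_filter: "(snd \<longlongrightarrow> z) (joint_filter Z z)"
  unfolding joint_filter_def by (rule filterlim_mono[OF filterlim_snd _ order_refl]) simp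

lemma eventually_snd_in_joint_filter: "eventually (\<lambda>p. snd p \<in> Z) (joint_filter Z z)"
  using eventually_joint_filter[of "\<lambda>_ y. y \<in> Z" Z z]
  by (auto simp: case_prod_beta' intro!: exI[of _ UNIV])

text \<open>The inner map may depend on the index, so that the lemma covers restriction to a subset,
fixing some coordinates of a product, and replacing a coordinate by a convergent sequence.\<close>

lemma joint_liminf_compose:
  assumes h: "\<And>\<nu> y. y \<in> Z' \<Longrightarrow> h \<nu> y \<in> Z"
    and lim: "((\<lambda>p. h (fst p) (snd p)) \<longlongrightarrow> w) (joint_filter Z' z)"
  shows "joint_liminf Z f w \<le> joint_liminf Z' (\<lambda>\<nu> y. f \<nu> (h \<nu> y)) z"
proof -
  have "eventually (\<lambda>p. h (fst p) (snd p) \<in> Z) (joint_filter Z' z)"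
    using eventually_snd_in_joint_filter by eventually_elim (rule h)
  from joint_liminf_le_Liminf[OF filterlim_fst_joint_filter this lim]
  show ?thesis by (simp add: joint_liminf_def[of Z'] case_prod_beta')
qed

lemma joint_liminf_mono:
  assumes "\<And>\<nu> y. y \<in> Z \<Longrightarrow> f \<nu> y \<le> g \<nu> y"
  shows "joint_liminf Z f z \<le> joint_liminf Z g z"
  unfolding joint_liminf_def case_prod_beta'
  by (intro Liminf_mono eventually_mono[OF eventually_snd_in_joint_filter]) (rule assms)

text \<open>Since \<open>p\<close> and \<open>q\<close> are real, the slack below the sum can be split between the two
terms, and no indeterminate sum arises even if \<open>w\<close> takes infinite values.\<close>

lemma Liminf_add_scaled:
  fixes p q b :: real
  assumes b: "b > 0"
    and p: "ereal p \<le> Liminf F (\<lambda>k. ereal (u k))"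
    and q: "ereal q \<le> Liminf F w"
  shows "ereal p + ereal b * ereal q \<le> Liminf F (\<lambda>k. ereal (u k) + ereal b * w k)"
  unfolding le_Liminf_iff
proof (intro allI impI)
  fix c assume "c < ereal p + ereal b * ereal q"
  then obtain d where d: "c < ereal d" "d < p + b * q"
    using ereal_dense2[of c "ereal (p + b * q)"] by auto
  define e where "e = (p + b * q - d) / 2"
  have e: "e > 0" using d by (simp add: e_def)
  have "ereal (p - e) < Liminf F (\<lambda>k. ereal (u k))"
    by (rule less_le_trans[OF _ p]) (use e in simp)
  then have "eventually (\<lambda>k. ereal (p - e) < ereal (u k)) F" by (rule less_LiminfD)
  moreover have "ereal (q - e / b) < Liminf F w"
    by (rule less_le_trans[OF _ q]) (use e b in simp)
  then have "eventually (\<lambda>k. ereal (q - e / b) < w k) F" by (rule less_LiminfD)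
  ultimately show "eventually (\<lambda>k. c < ereal (u k) + ereal b * w k) F"
  proof eventually_elim
    case (elim k)
    have "ereal b * ereal (q - e / b) \<le> ereal b * w k"
      using elim b by (intro ereal_mult_left_mono) auto
    then have "ereal (p - e) + ereal b * ereal (q - e / b) \<le> ereal (u k) + ereal b * w k"
      using elim by (intro add_mono) auto
    moreover have "ereal (p - e) + ereal b * ereal (q - e / b) = ereal d"
      using b by (simp add: e_def field_simps)
    ultimately show ?case using d(1) by simp
  qed
qed

text \<open>Epi-convergence quantifies over full sequences, whereas a failure of the joint lower limit only
yields bad points at infinitely many indices. Filling the gaps between these indices with the limit
point itself produces a full sequence that contradicts the assumption.\<close>

lemma sequential_liminf_imp_joint:
  fixes Z :: "'a::metric_space set"
  assumes z: "z \<in> Z"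
    and seq: "\<And>s. (\<And>\<nu>. s \<nu> \<in> Z) \<Longrightarrow> s \<longlonglongrightarrow> z \<Longrightarrow> g \<le> liminf (\<lambda>\<nu>. f \<nu> (s \<nu>))"
  shows "g \<le> joint_liminf Z f z"
proof (rule le_joint_liminfI, rule ccontr)
  fix c assume c: "c < g"
    and no: "\<not> (\<exists>N U. open U \<and> z \<in> U \<and> (\<forall>\<nu>\<ge>N. \<forall>y\<in>U \<inter> Z. c \<le> f \<nu> y))"
  have bad: "\<exists>\<nu>>n. \<exists>y\<in>Z. dist y z < 1 / Suc k \<and> f \<nu> y < c" for n k
  proof -
    have "\<not> (\<forall>\<nu>\<ge>Suc n. \<forall>y\<in>ball z (1 / Suc k) \<inter> Z. c \<le> f \<nu> y)"
      using no by (metis centre_in_ball open_ball of_nat_0_less_iff zero_less_Suc zero_less_divide_1_iff)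
    then obtain \<nu> y where "\<nu> \<ge> Suc n" "y \<in> ball z (1 / Suc k)" "y \<in> Z" "f \<nu> y < c"
      by (auto simp: not_le)
    then have "n < \<nu>" "y \<in> Z" "dist y z < 1 / Suc k" "f \<nu> y < c" by (auto simp: dist_commute)
    then show ?thesis by blast
  qed
  have "\<exists>r. \<forall>k. (\<exists>y\<in>Z. dist y z < 1 / Suc k \<and> f (r k) y < c) \<and> r k < r (Suc k)"
    by (rule dependent_nat_choice) (use bad in blast)+
  then obtain r where r: "\<And>k. \<exists>y\<in>Z. dist y z < 1 / Suc k \<and> f (r k) y < c"
    and mono: "strict_mono r" by (auto simp: strict_mono_Suc_iff)
  obtain w where w: "\<And>k. w k \<in> Z" "\<And>k. dist (w k) z < 1 / Suc k" "\<And>k. f (r k) (w k) < c"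
    using r by metis
  define s where "s = (\<lambda>\<nu>. if \<nu> \<in> range r then w (inv r \<nu>) else z)"
  have sr: "s (r k) = w k" for k
    using mono by (simp add: s_def strict_mono_imp_inj_on)
  have "s \<longlonglongrightarrow> z"
  proof (rule metric_LIMSEQ_I)
    fix e :: real assume "e > 0"
    then obtain K where K: "1 / Suc K < e"
      using nat_approx_posE by blast
    have "dist (s \<nu>) z < e" if "\<nu> \<ge> r K" for \<nu>
    proof (cases "\<nu> \<in> range r")
      case True
      then obtain k where k: "\<nu> = r k" by blast
      have "K \<le> k" using that mono by (simp add: k strict_mono_less_eq)
      then have "1 / Suc k \<le> 1 / Suc K" by (simp add: frac_le)
      then show ?thesis using w(2)[of k] K by (simp add: k sr)
    next
      case False
      then show ?thesis using \<open>e > 0\<close> by (simp add: s_def)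
    qed
    then show "\<exists>no. \<forall>n\<ge>no. dist (s n) z < e" by blast
  qed
  moreover have "s \<nu> \<in> Z" for \<nu> using w(1) z by (auto simp: s_def)
  ultimately have "g \<le> liminf (\<lambda>\<nu>. f \<nu> (s \<nu>))" by (intro seq)
  with c have "c < liminf (\<lambda>\<nu>. f \<nu> (s \<nu>))" by (rule less_le_trans)
  then have "eventually (\<lambda>\<nu>. c < f \<nu> (s \<nu>)) sequentially" by (rule less_LiminfD)
  then obtain N where "\<And>\<nu>. \<nu> \<ge> N \<Longrightarrow> c < f \<nu> (s \<nu>)" by (auto simp: eventually_sequentially)
  from this[of "r N"] show False
    using w(3)[of N] seq_suble[OF mono, of N] by (auto simp: sr)
qed

text \<open>Pointwise convergence provides the recovery sequence, namely the constant one.\<close>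

lemma epi_convI:
  assumes "\<And>z. z \<in> Z \<Longrightarrow> g z \<le> joint_liminf Z f z" "pointwise_conv Z f g"
  shows "epi_conv Z f g"
  unfolding epi_conv_def
proof (intro ballI conjI allI impI)
  fix z s assume z: "z \<in> Z" and s: "(\<forall>\<nu>. s \<nu> \<in> Z) \<and> s \<longlonglongrightarrow> z"
  have "g z \<le> joint_liminf Z f z" using assms(1) z .
  also have "\<dots> \<le> liminf (\<lambda>\<nu>. f \<nu> (s \<nu>))"
    by (rule joint_liminf_le_Liminf) (use s in \<open>auto simp: filterlim_ident\<close>)
  finally show "g z \<le> liminf (\<lambda>\<nu>. f \<nu> (s \<nu>))" .
next
  fix z assume z: "z \<in> Z"
  then have "limsup (\<lambda>\<nu>. f \<nu> z) = g z"
    using assms(2) by (auto simp: pointwise_conv_def intro!: lim_imp_Limsup)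
  then show "\<exists>s. (\<forall>\<nu>. s \<nu> \<in> Z) \<and> s \<longlonglongrightarrow> z \<and> limsup (\<lambda>\<nu>. f \<nu> (s \<nu>)) \<le> g z"
    using z by (intro exI[of _ "\<lambda>_. z"]) auto
qed

lemma epi_conv_imp_le_joint_liminf:
  fixes Z :: "'a::metric_space set"
  assumes "epi_conv Z f g" "z \<in> Z"
  shows "g z \<le> joint_liminf Z f z"
  using assms by (intro sequential_liminf_imp_joint) (auto simp: epi_conv_def)

text \<open>Equi-lower semicontinuity bounds \<open>f \<nu>\<close> near \<open>z\<close> from below by its value at
\<open>z\<close> up to a small error, uniformly in \<open>\<nu>\<close>, and the values at \<open>z\<close> converge.
The cap \<open>\<rho>\<close> does no harm because it can be chosen above any given level \<open>c\<close>.\<close>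

lemma equi_lsc_imp_le_joint_liminf:
  assumes f: "equi_lsc Z f" and z: "z \<in> Z" and lim: "(\<lambda>\<nu>. f \<nu> z) \<longlonglongrightarrow> g" and g: "g \<noteq> -\<infinity>"
  shows "g \<le> joint_liminf Z f z"
proof (rule le_joint_liminfI)
  fix c assume c: "c < g"
  have "\<not> (\<lambda>\<nu>. f \<nu> z) \<longlonglongrightarrow> - \<infinity>"
    using lim g LIMSEQ_unique by blast
  then have unif: "\<exists>N. \<exists>\<delta>>0. \<forall>\<nu>\<ge>N. (INF y\<in>{y \<in> Z. norm (y - z) \<le> \<delta>}. f \<nu> y)
      \<ge> min (f \<nu> z - ereal \<epsilon>) (ereal \<rho>)" if "\<rho> > 0" "\<epsilon> > 0" for \<rho> \<epsilon> :: real
    using f z that unfolding equi_lsc_def by blast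
  show "\<exists>N U. open U \<and> z \<in> U \<and> (\<forall>\<nu>\<ge>N. \<forall>y\<in>U \<inter> Z. c \<le> f \<nu> y)"
  proof (cases "c = -\<infinity>")
    case True
    then show ?thesis by (intro exI[of _ 0] exI[of _ UNIV]) auto
  next
    case False
    then obtain a where a: "c = ereal a" using c by (cases c) auto
    obtain d where d: "a < d" "ereal d < g" using ereal_dense2[OF c] by (auto simp: a)
    define \<epsilon> where "\<epsilon> = d - a"
    define \<rho> where "\<rho> = \<bar>a\<bar> + 1"
    have pos: "\<epsilon> > 0" "\<rho> > 0" using d by (auto simp: \<epsilon>_def \<rho>_def)
    obtain N1 \<delta> where \<delta>: "\<delta> > 0" "\<And>\<nu>. \<nu> \<ge> N1 \<Longrightarrow>
        (INF y\<in>{y \<in> Z. norm (y - z) \<le> \<delta>}. f \<nu> y) \<ge> min (f \<nu> z - ereal \<epsilon>) (ereal \<rho>)"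
      using unif[OF pos(2,1)] by blast
    obtain N2 where N2: "\<And>\<nu>. \<nu> \<ge> N2 \<Longrightarrow> ereal d < f \<nu> z"
      using order_tendstoD(1)[OF lim d(2)] by (auto simp: eventually_sequentially)
    have "c \<le> f \<nu> y" if "\<nu> \<ge> max N1 N2" "y \<in> ball z \<delta> \<inter> Z" for \<nu> y
    proof -
      have "ereal d - ereal \<epsilon> \<le> f \<nu> z - ereal \<epsilon>"
        using N2[of \<nu>] that by (intro ereal_minus_mono) auto
      then have "c \<le> f \<nu> z - ereal \<epsilon>" by (simp add: a \<epsilon>_def)
      moreover have "c \<le> ereal \<rho>" by (simp add: a \<rho>_def)
      ultimately have "c \<le> min (f \<nu> z - ereal \<epsilon>) (ereal \<rho>)" by simp
      also have "\<dots> \<le> (INF y\<in>{y \<in> Z. norm (y - z) \<le> \<delta>}. f \<nu> y)"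
        using \<delta>(2) that by simp
      also have "\<dots> \<le> f \<nu> y"
        using that by (intro INF_lower) (auto simp: dist_norm norm_minus_commute)
      finally show ?thesis .
    qed
    then show ?thesis
      using \<delta>(1) by (intro exI[of _ "max N1 N2"] exI[of _ "ball z \<delta>"]) auto
  qed
qed

section \<open>Minimisation over compact sets\<close>

text \<open>Letting the index tend to infinity transfers a joint lower bound on a neighbourhood to the
pointwise limit; this is how the limit inherits lower semicontinuity.\<close>

lemma le_limit_near:
  assumes "\<And>\<nu> y. \<nu> \<ge> N \<Longrightarrow> y \<in> U \<Longrightarrow> y \<in> K \<Longrightarrow> c < h \<nu> y"
    and "\<And>y. y \<in> K \<Longrightarrow> (\<lambda>\<nu>. h \<nu> y) \<longlonglongrightarrow> h0 y" and "y \<in> U" "y \<in> K"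
  shows "(c::ereal) \<le> h0 y"
  by (rule LIMSEQ_le_const[OF assms(2)])
     (use assms in \<open>auto intro!: exI[of _ N] less_imp_le\<close>)

text \<open>The upper bound comes from pointwise convergence at near-minimisers of the limit. For the lower bound, every point of
\<open>K\<close> has a neighbourhood on which the functions eventually exceed a given level below the limiting
infimum; finitely many of these neighbourhoods cover \<open>K\<close>.\<close>

lemma INF_tendsto_compact:
  assumes K: "compact K"
    and lim: "\<And>y. y \<in> K \<Longrightarrow> (\<lambda>\<nu>. h \<nu> y) \<longlonglongrightarrow> h0 y"
    and lower: "\<And>y. y \<in> K \<Longrightarrow> h0 y \<le> joint_liminf K h y"
  shows "(\<lambda>\<nu>. INF y\<in>K. h \<nu> y) \<longlonglongrightarrow> (INF y\<in>K. h0 y)"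
proof (rule order_tendstoI)
  fix c assume "c < (INF y\<in>K. h0 y)"
  then obtain d where d: "c < d" "d < (INF y\<in>K. h0 y)" using dense by blast
  have "\<exists>N U. open U \<and> y \<in> U \<and> (\<forall>\<nu>\<ge>N. \<forall>y'\<in>U \<inter> K. d < h \<nu> y')" if "y \<in> K" for y
  proof -
    have "d < h0 y" using d that by (metis INF_lower less_le_trans)
    also have "\<dots> \<le> joint_liminf K h y" using lower that .
    finally show ?thesis by (rule less_joint_liminfD) blast
  qed
  then obtain N U where NU: "\<And>y. y \<in> K \<Longrightarrow> open (U y)" "\<And>y. y \<in> K \<Longrightarrow> y \<in> U y"
    "\<And>y \<nu> y'. y \<in> K \<Longrightarrow> \<nu> \<ge> N y \<Longrightarrow> y' \<in> U y \<inter> K \<Longrightarrow> d < h \<nu> y'"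
    by metis
  obtain D where D: "D \<subseteq> K" "finite D" "K \<subseteq> (\<Union>y\<in>D. U y)"
    by (rule compactE_image[OF K, of K U]) (use NU in auto)
  have "c < (INF y\<in>K. h \<nu> y)" if "\<nu> \<ge> (\<Sum>y\<in>D. N y)" for \<nu>
  proof -
    have "d \<le> h \<nu> y'" if y': "y' \<in> K" for y'
    proof -
      obtain y where y: "y \<in> D" "y' \<in> U y" using D y' by blast
      have "N y \<le> (\<Sum>y\<in>D. N y)" using D y by (intro member_le_sum) auto
      then show ?thesis using NU(3)[of y \<nu> y'] D y y' \<open>\<nu> \<ge> _\<close> by fastforce
    qed
    then have "d \<le> (INF y\<in>K. h \<nu> y)" by (intro INF_greatest)
    then show ?thesis using d(1) by simp
  qed
  then show "eventually (\<lambda>\<nu>. c < (INF y\<in>K. h \<nu> y)) sequentially"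
    unfolding eventually_sequentially by blast
next
  fix c assume "(INF y\<in>K. h0 y) < c"
  then obtain y where y: "y \<in> K" "h0 y < c" by (auto simp: INF_less_iff)
  have "eventually (\<lambda>\<nu>. h \<nu> y < c) sequentially" using order_tendstoD(2)[OF lim[OF y(1)] y(2)] .
  then show "eventually (\<lambda>\<nu>. (INF y\<in>K. h \<nu> y) < c) sequentially"
    by eventually_elim (use y in \<open>auto intro: le_less_trans INF_lower\<close>)
qed

text \<open>This is the extreme value theorem for the lower semicontinuous limit: were the infimum not
attained, each point would have a neighbourhood with a lower bound strictly above the infimum, and
by compactness a single such bound would hold on all of \<open>K\<close>.\<close>

lemma compact_limit_attains_INF:
  assumes K: "compact K" "K \<noteq> {}"
    and lim: "\<And>y. y \<in> K \<Longrightarrow> (\<lambda>\<nu>. h \<nu> y) \<longlonglongrightarrow> h0 y"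
    and lower: "\<And>y. y \<in> K \<Longrightarrow> h0 y \<le> joint_liminf K h y"
  obtains y where "y \<in> K" "h0 y = (INF y\<in>K. h0 y)"
proof (rule ccontr)
  assume "\<not> thesis"
  with that have "h0 y \<noteq> (INF y\<in>K. h0 y)" if "y \<in> K" for y using \<open>y \<in> K\<close> by blast
  then have strict: "(INF y\<in>K. h0 y) < h0 y" if "y \<in> K" for y
    using that by (metis INF_lower order_le_neq_trans)
  have "\<exists>U d. open U \<and> y \<in> U \<and> (INF y\<in>K. h0 y) < d \<and> (\<forall>y'\<in>U \<inter> K. d \<le> h0 y')" if y: "y \<in> K" for y
  proof -
    obtain d where d: "(INF y\<in>K. h0 y) < d" "d < h0 y" using strict[OF y] dense by blast
    have "d < joint_liminf K h y" using d(2) lower[OF y] by simp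
    then obtain N U where U: "open U" "y \<in> U"
      and "\<And>\<nu> y. \<nu> \<ge> N \<Longrightarrow> y \<in> U \<Longrightarrow> y \<in> K \<Longrightarrow> d < h \<nu> y"
      using less_joint_liminfD by metis
    then have "d \<le> h0 y'" if "y' \<in> U \<inter> K" for y'
      using le_limit_near[of N U K d h h0 y'] lim that by blast
    with U d show ?thesis by blast
  qed
  then obtain U d where U: "\<And>y. y \<in> K \<Longrightarrow> open (U y)" "\<And>y. y \<in> K \<Longrightarrow> y \<in> U y"
    "\<And>y. y \<in> K \<Longrightarrow> (INF y\<in>K. h0 y) < d y"
    "\<And>y y'. y \<in> K \<Longrightarrow> y' \<in> U y \<inter> K \<Longrightarrow> d y \<le> h0 y'"
    by metis
  obtain D where D: "D \<subseteq> K" "finite D" "K \<subseteq> (\<Union>y\<in>D. U y)"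
    by (rule compactE_image[OF K(1), of K U]) (use U in auto)
  have ne: "D \<noteq> {}" using D K by auto
  have "Min (d ` D) \<le> (INF y\<in>K. h0 y)"
  proof (rule INF_greatest)
    fix y' assume y': "y' \<in> K"
    then obtain y where y: "y \<in> D" "y' \<in> U y" using D by blast
    have "Min (d ` D) \<le> d y" using D y by auto
    also have "\<dots> \<le> h0 y'" using U(4) D y y' by blast
    finally show "Min (d ` D) \<le> h0 y'" .
  qed
  moreover have "(INF y\<in>K. h0 y) < Min (d ` D)"
    using D ne U(3) by (auto simp: Min_gr_iff)
  ultimately show False by simp
qed

text \<open>At a limit of minimisers the limit function is at most the lower limit of the minimal values,
and these are at most the values at any competitor, which converge.\<close>

lemma LimOut_argmin_subset:
  assumes K: "closed K"
    and lim: "\<And>y. y \<in> K \<Longrightarrow> (\<lambda>\<nu>. h \<nu> y) \<longlonglongrightarrow> h0 y"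
    and lower: "\<And>y. y \<in> K \<Longrightarrow> h0 y \<le> joint_liminf K h y"
  shows "LimOut (\<lambda>\<nu>. argmin_on K (h \<nu>)) \<subseteq> argmin_on K h0"
proof
  fix y assume "y \<in> LimOut (\<lambda>\<nu>. argmin_on K (h \<nu>))"
  then obtain r s where r: "strict_mono r" and s: "\<And>k. s k \<in> argmin_on K (h (r k))" "s \<longlonglongrightarrow> y"
    unfolding LimOut_def by auto
  have sK: "s k \<in> K" for k using s(1)[of k] by (auto simp: argmin_on_def is_arg_min_def)
  have y: "y \<in> K" using K sK s(2) by (rule closed_sequentially)
  have "h0 y \<le> h0 y'" if y': "y' \<in> K" for y'
  proof -
    have r': "filterlim r sequentially sequentially" using r by (rule filterlim_subseq)
    have "h0 y \<le> joint_liminf K h y" using lower[OF y] .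
    also have "\<dots> \<le> liminf (\<lambda>k. h (r k) (s k))"
      by (rule joint_liminf_le_Liminf[OF r' _ s(2)]) (simp add: sK)
    also have "\<dots> \<le> liminf (\<lambda>k. h (r k) y')"
      using s(1) y' by (intro Liminf_mono always_eventually)
        (auto simp: argmin_on_def is_arg_min_linorder)
    also have "\<dots> = h0 y'"
      using filterlim_compose[OF lim[OF y'] r'] by (intro lim_imp_Liminf) auto
    finally show ?thesis .
  qed
  then show "y \<in> argmin_on K h0" using y by (auto simp: argmin_on_def is_arg_min_linorder)
qed

section \<open>Extended-real expectations\<close>

text \<open>An integrable function is finite almost everywhere, so that its expectation, a difference of
two nonnegative integrals, can be computed as an ordinary Bochner integral.\<close>

lemma ereal_integrable_cases:
  assumes "ereal_integrable M f"
  shows ereal_integrable_AE_finite: "AE x in M. f x = ereal (real_of_ereal (f x))"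
    and integrable_real_of_ereal: "integrable M (\<lambda>x. real_of_ereal (f x))"
    and ereal_expectation_eq_integral:
      "ereal_expectation M f = ereal (\<integral>x. real_of_ereal (f x) \<partial>M)"
proof -
  have [measurable]: "f \<in> borel_measurable M"
    and fin: "(\<integral>\<^sup>+ x. e2ennreal \<bar>f x\<bar> \<partial>M) < \<infinity>"
    using assms by (auto simp: ereal_integrable_def)
  have "AE x in M. e2ennreal \<bar>f x\<bar> \<noteq> \<infinity>"
    by (rule nn_integral_PInf_AE) (use fin in auto)
  then show AE: "AE x in M. f x = ereal (real_of_ereal (f x))"
    by eventually_elim (auto simp: ereal_real)
  have "(\<integral>\<^sup>+ x. ennreal (norm (real_of_ereal (f x))) \<partial>M) = (\<integral>\<^sup>+ x. e2ennreal \<bar>f x\<bar> \<partial>M)"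
    by (rule nn_integral_cong_AE) (use AE in \<open>eventually_elim, metis abs_ereal.simps(1) e2ennreal_ereal real_norm_def\<close>)
  then show int: "integrable M (\<lambda>x. real_of_ereal (f x))"
    using fin by (simp add: integrable_iff_bounded)
  have pos: "(\<integral>\<^sup>+ x. e2ennreal (f x) \<partial>M) = (\<integral>\<^sup>+ x. ennreal (real_of_ereal (f x)) \<partial>M)"
    by (rule nn_integral_cong_AE) (use AE in \<open>eventually_elim, metis e2ennreal_ereal\<close>)
  have neg: "(\<integral>\<^sup>+ x. e2ennreal (- f x) \<partial>M) = (\<integral>\<^sup>+ x. ennreal (- real_of_ereal (f x)) \<partial>M)"
    by (rule nn_integral_cong_AE) (use AE in \<open>eventually_elim, metis e2ennreal_ereal uminus_ereal.simps(1)\<close>)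
  have "(\<integral>\<^sup>+ x. ennreal (real_of_ereal (f x)) \<partial>M) \<noteq> \<top>"
    "(\<integral>\<^sup>+ x. ennreal (- real_of_ereal (f x)) \<partial>M) \<noteq> \<top>"
    using int unfolding real_integrable_def by auto
  then show "ereal_expectation M f = ereal (\<integral>x. real_of_ereal (f x) \<partial>M)"
    unfolding ereal_expectation_def pos neg real_lebesgue_integral_def[OF int]
    by (metis ennreal_enn2real enn2ereal_ennreal enn2real_nonneg ereal_minus(1) infinity_ennreal_def less_top)
qed

lemma ereal_integrable_uminus:
  "ereal_integrable M f \<Longrightarrow> ereal_integrable M (\<lambda>x. - f x)"
  by (auto simp: ereal_integrable_def)

lemma ereal_expectation_uminus:
  assumes "ereal_integrable M f"
  shows "ereal_expectation M (\<lambda>x. - f x) = - ereal_expectation M f"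
  using ereal_expectation_eq_integral[OF assms]
    ereal_expectation_eq_integral[OF ereal_integrable_uminus[OF assms]] by simp

lemma ereal_integrable_truncate:
  assumes "ereal_integrable M f" "Measurable.pred M Q"
  shows "ereal_integrable M (\<lambda>x. f x * of_bool (Q x))"
proof -
  have [measurable]: "f \<in> borel_measurable M" "Measurable.pred M Q"
    and fin: "(\<integral>\<^sup>+ x. e2ennreal \<bar>f x\<bar> \<partial>M) < \<infinity>"
    using assms by (auto simp: ereal_integrable_def)
  have eq: "(\<lambda>x. f x * of_bool (Q x)) = (\<lambda>x. if Q x then f x else 0)" by auto
  have "(\<lambda>x. if Q x then f x else 0) \<in> borel_measurable M" by measurable
  moreover have "(\<integral>\<^sup>+ x. e2ennreal \<bar>if Q x then f x else 0\<bar> \<partial>M) \<le> (\<integral>\<^sup>+ x. e2ennreal \<bar>f x\<bar> \<partial>M)"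
    by (intro nn_integral_mono) (auto intro: e2ennreal_mono)
  ultimately show ?thesis unfolding eq ereal_integrable_def using fin by (auto intro: le_less_trans)
qed

section \<open>Lipschitz minorants\<close>

definition clamp_real :: "real \<Rightarrow> real \<Rightarrow> ereal \<Rightarrow> real" where
  "clamp_real a b v = real_of_ereal (max (ereal a) (min (ereal b) v))"

lemma ereal_clamp_real: "ereal (clamp_real a b v) = max (ereal a) (min (ereal b) v)"
  unfolding clamp_real_def by (cases v) (auto simp: max_def min_def)

lemma clamp_real_bounds: "a \<le> b \<Longrightarrow> a \<le> clamp_real a b v \<and> clamp_real a b v \<le> b"
  using ereal_clamp_real[of a b v] by (cases v) (auto simp: max_def min_def split: if_splits)

text \<open>The greatest \<open>k\<close>-Lipschitz function below all functions \<open>f \<nu>\<close> with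
\<open>\<nu> \<ge> k\<close> after these are truncated to \<open>[a, k]\<close> (a Pasch-Hausdorff envelope). The truncation makes
it bounded and real-valued, hence an admissible test function for weak convergence.\<close>

definition lipschitz_minorant ::
    "'b::metric_space set \<Rightarrow> (nat \<Rightarrow> 'b \<Rightarrow> ereal) \<Rightarrow> real \<Rightarrow> nat \<Rightarrow> 'b \<Rightarrow> real" where
  "lipschitz_minorant Z f a k z =
     (INF (\<nu>, y)\<in>{k..} \<times> Z. clamp_real a k (f \<nu> y) + k * dist y z)"

context
  fixes Z :: "'b::metric_space set" and f :: "nat \<Rightarrow> 'b \<Rightarrow> ereal" and a :: real
  assumes a: "a \<le> 0"
begin

lemma minorant_bdd_below:
  "bdd_below ((\<lambda>(\<nu>, y). clamp_real a (real k) (f \<nu> y) + real k * dist y z) ` ({k..} \<times> Z))"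
  using clamp_real_bounds[of a "real k"] a
  by (intro bdd_belowI[of _ a]) (auto intro!: add_increasing2)

lemma lipschitz_minorant_le_term:
  assumes "\<nu> \<ge> k" "y \<in> Z"
  shows "lipschitz_minorant Z f a k z \<le> clamp_real a k (f \<nu> y) + k * dist y z"
  unfolding lipschitz_minorant_def
  using cINF_lower[OF minorant_bdd_below, of "(\<nu>, y)"] assms by auto

lemma lipschitz_minorant_le:
  assumes "\<nu> \<ge> k" "z \<in> Z"
  shows "lipschitz_minorant Z f a k z \<le> clamp_real a k (f \<nu> z)"
  using lipschitz_minorant_le_term[OF assms, of z] by simp

lemma lipschitz_minorant_greatest:
  assumes "Z \<noteq> {}" "\<And>\<nu> y. \<nu> \<ge> k \<Longrightarrow> y \<in> Z \<Longrightarrow> c \<le> clamp_real a k (f \<nu> y) + k * dist y z"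
  shows "c \<le> lipschitz_minorant Z f a k z"
  unfolding lipschitz_minorant_def using assms by (intro cINF_greatest) auto

lemma lipschitz_minorant_ge:
  assumes "Z \<noteq> {}"
  shows "a \<le> lipschitz_minorant Z f a k z"
  using assms clamp_real_bounds[of a "real k"] a
  by (intro lipschitz_minorant_greatest) (auto intro!: add_increasing2)

lemma bounded_lipschitz_minorant: "bounded (lipschitz_minorant Z f a k ` Z)"
proof -
  have "lipschitz_minorant Z f a k z \<in> {a..real k}" if z: "z \<in> Z" for z
    using lipschitz_minorant_ge[of k z] lipschitz_minorant_le[of k k z] z
      clamp_real_bounds[of a "real k" "f k z"] a by auto
  then have "lipschitz_minorant Z f a k ` Z \<subseteq> {a..real k}" by blast
  then show ?thesis using bounded_subset bounded_closed_interval by blast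
qed

lemma continuous_on_lipschitz_minorant: "continuous_on Z (lipschitz_minorant Z f a k)"
proof -
  have le: "lipschitz_minorant Z f a k z \<le> lipschitz_minorant Z f a k z' + k * dist z z'"
    if "z \<in> Z" for z z'
  proof -
    have "lipschitz_minorant Z f a k z - k * dist z z' \<le> lipschitz_minorant Z f a k z'"
    proof (rule lipschitz_minorant_greatest)
      fix \<nu> y assume *: "\<nu> \<ge> k" "y \<in> Z"
      have "real k * dist y z \<le> k * (dist y z' + dist z z')"
        by (intro mult_left_mono dist_triangle2) auto
      then show "lipschitz_minorant Z f a k z - k * dist z z'
          \<le> clamp_real a k (f \<nu> y) + k * dist y z'"
        using lipschitz_minorant_le_term[OF *, of z] by (simp add: algebra_simps)
    qed (use that in auto)
    then show ?thesis by simp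
  qed
  have "(real k)-lipschitz_on Z (lipschitz_minorant Z f a k)"
  proof (rule lipschitz_onI)
    fix z z' assume "z \<in> Z" "z' \<in> Z"
    then show "dist (lipschitz_minorant Z f a k z) (lipschitz_minorant Z f a k z') \<le> real k * dist z z'"
      using le[of z z'] le[of z' z] by (simp add: dist_real_def dist_commute abs_le_iff)
  qed simp
  then show ?thesis by (rule lipschitz_on_continuous_on)
qed

text \<open>The minorants recover the joint lower limit as \<open>k\<close> grows: terms with \<open>y\<close> near
\<open>z\<close> are controlled by the joint lower limit, while for the others the penalty
\<open>k * dist y z\<close> exceeds any bound.\<close>

lemma lipschitz_minorant_eventually_gt:
  assumes z: "z \<in> Z" and c: "ereal c < max (ereal a) (joint_liminf Z f z)"
  shows "eventually (\<lambda>k. c < lipschitz_minorant Z f a k z) sequentially"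
proof (cases "c < a")
  case True
  then show ?thesis using lipschitz_minorant_ge z
    by (intro always_eventually allI) (metis empty_iff less_le_trans)
next
  case False
  then have "ereal c < joint_liminf Z f z" using c by (auto simp: less_max_iff_disj)
  then obtain d where d: "c < d" "ereal d < joint_liminf Z f z"
    using ereal_dense2 by (metis less_ereal.simps(1))
  obtain N U where U: "open U" "z \<in> U" "\<And>\<nu> y. \<nu> \<ge> N \<Longrightarrow> y \<in> U \<Longrightarrow> y \<in> Z \<Longrightarrow> d < f \<nu> y"
    using less_joint_liminfD[OF d(2)] by metis
  obtain \<delta> where \<delta>: "\<delta> > 0" "ball z \<delta> \<subseteq> U" using U openE by blast
  have "eventually (\<lambda>k. real k \<ge> max d ((d - a) / \<delta>)) sequentially"
    by (rule eventually_at_top_linorderI[of "nat \<lceil>max d ((d - a) / \<delta>)\<rceil>"]) linarith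
  then show ?thesis using eventually_ge_at_top[of N]
  proof eventually_elim
    case (elim k)
    have "d \<le> lipschitz_minorant Z f a k z"
    proof (rule lipschitz_minorant_greatest)
      fix \<nu> y assume *: "\<nu> \<ge> k" "y \<in> Z"
      have pos: "0 \<le> real k * dist y z" by simp
      show "d \<le> clamp_real a (real k) (f \<nu> y) + real k * dist y z"
      proof (cases "dist y z < \<delta>")
        case True
        then have "y \<in> U" using \<delta> by (auto simp: dist_commute)
        then have "ereal d < f \<nu> y" using U(3) * elim by auto
        then have "ereal d \<le> ereal (clamp_real a (real k) (f \<nu> y))"
          unfolding ereal_clamp_real using elim by (auto simp: le_max_iff_disj)
        then have "d \<le> clamp_real a (real k) (f \<nu> y)" by simp
        then show ?thesis using pos by linarith
      next
        case False
        have "d - a \<le> real k * \<delta>" using elim \<delta>(1) by (simp add: pos_divide_le_eq)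
        also have "\<dots> \<le> real k * dist y z" using False by (intro mult_left_mono) auto
        finally show ?thesis using clamp_real_bounds[of a "real k" "f \<nu> y"] a by auto
      qed
    qed (use z in auto)
    then show ?case using d by simp
  qed
qed

end

section \<open>Fatou's lemma under weak convergence\<close>

lemma borel_prob_on_space: "borel_prob_on Z M \<Longrightarrow> space M = Z"
  unfolding borel_prob_on_def by (auto dest: sets_eq_imp_space_eq simp: space_restrict_space)

lemma borel_prob_on_integrable_continuous:
  fixes h :: "'b::topological_space \<Rightarrow> real"
  assumes M: "borel_prob_on Z M" and h: "continuous_on Z h" "bounded (h ` Z)"
  shows "integrable M h"
proof -
  interpret prob_space M using M by (simp add: borel_prob_on_def)
  obtain C where "\<And>z. z \<in> Z \<Longrightarrow> norm (h z) \<le> C" using h(2) by (auto simp: bounded_iff)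
  moreover have "h \<in> borel_measurable M"
    using borel_measurable_continuous_on_restrict[OF h(1)] M
    by (simp add: borel_prob_on_def cong: measurable_cong_sets)
  ultimately show ?thesis
    using borel_prob_on_space[OF M] by (intro integrable_const_bound[of _ C]) auto
qed

text \<open>Fatou's lemma for varying integrands and weakly converging measures. A bounded Lipschitz
minorant \<open>H K\<close> of all \<open>gn \<nu>\<close> with \<open>\<nu> \<ge> K\<close>, truncated below at \<open>\<tau>\<close>,
may be integrated through the weak limit, and its integral against \<open>P\<close> is almost as large as that of
\<open>g\<close> when \<open>K\<close> is large. The truncation at \<open>\<tau>\<close> costs only the lower tail, which is
assumed to be small uniformly in \<open>\<nu>\<close>.\<close>

lemma fatou_weak_conv:
  fixes Z :: "'b::metric_space set"
  assumes P: "borel_prob_on Z P" and Pn: "\<And>\<nu>. borel_prob_on Z (Pn \<nu>)"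
    and weak: "weak_conv_on Z Pn P"
    and g: "ereal_integrable P g" and gn: "\<And>\<nu>. ereal_integrable (Pn \<nu>) (gn \<nu>)"
    and lower: "\<And>z. z \<in> Z \<Longrightarrow> g z \<le> joint_liminf Z gn z"
    and tail: "\<And>\<epsilon>. \<epsilon> > 0 \<Longrightarrow> \<exists>\<tau><0. eventually (\<lambda>\<nu>.
      - ereal \<epsilon> < ereal_expectation (Pn \<nu>) (\<lambda>z. gn \<nu> z * of_bool (gn \<nu> z \<le> ereal \<tau>))) sequentially"
  shows "ereal_expectation P g \<le> liminf (\<lambda>\<nu>. ereal_expectation (Pn \<nu>) (gn \<nu>))"
  unfolding ereal_expectation_eq_integral[OF g] le_Liminf_iff
proof (intro allI impI)
  interpret P: prob_space P using P by (simp add: borel_prob_on_def)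
  let ?G = "\<lambda>z. real_of_ereal (g z)"
  have G: "integrable P ?G" using g by (rule integrable_real_of_ereal)
  fix c' assume "c' < ereal (integral\<^sup>L P ?G)"
  then obtain c where c: "c' < ereal c" "c < integral\<^sup>L P ?G"
    using ereal_dense2 by (metis less_ereal.simps(1))
  \<comment> \<open>Half of the gap pays for the lower tail, the other half for passing from the limit to \<open>H K\<close>.\<close>
  define e where "e = (integral\<^sup>L P ?G - c) / 2"
  have e: "e > 0" using c by (simp add: e_def)
  from tail[OF e] obtain \<tau> where \<tau>: "\<tau> < 0" and ev: "eventually (\<lambda>\<nu>. - ereal e <
      ereal_expectation (Pn \<nu>) (\<lambda>z. gn \<nu> z * of_bool (gn \<nu> z \<le> ereal \<tau>))) sequentially"
    by blast
  define H where "H = lipschitz_minorant Z gn \<tau>"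
  have H: "integrable M (H k)" if "borel_prob_on Z M" for M k
    unfolding H_def using that \<tau>
    by (intro borel_prob_on_integrable_continuous[of Z] continuous_on_lipschitz_minorant
        bounded_lipschitz_minorant) auto
  let ?GT = "\<lambda>z. max \<tau> (?G z)"
  have GT: "integrable P ?GT" using G by simp
  have H_ge: "\<tau> \<le> H k z" if "z \<in> Z" for k z
    unfolding H_def using \<tau> that by (intro lipschitz_minorant_ge) auto
  \<comment> \<open>Capping \<open>H k\<close> by the truncated limit gives an integrable majorant for dominated convergence.\<close>
  have "AE z in P. (\<lambda>k. min (H k z) (?GT z)) \<longlonglongrightarrow> ?GT z"
    using ereal_integrable_AE_finite[OF g] AE_space
  proof eventually_elim
    case (elim z)
    then have z: "z \<in> Z" using borel_prob_on_space[OF P] by simp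
    show ?case
    proof (rule order_tendstoI)
      fix d assume d: "d < ?GT z"
      have "ereal (?G z) \<le> joint_liminf Z gn z" using lower[OF z] elim by simp
      then have "ereal d < max (ereal \<tau>) (joint_liminf Z gn z)"
        using d by (auto simp: less_max_iff_disj intro: less_le_trans[of _ "ereal (?G z)"])
      then have "eventually (\<lambda>k. d < H k z) sequentially"
        unfolding H_def using \<tau> z by (intro lipschitz_minorant_eventually_gt) auto
      then show "eventually (\<lambda>k. d < min (H k z) (?GT z)) sequentially"
        by eventually_elim (use d in auto)
    qed (auto simp: min_less_iff_disj)
  qed
  then have "(\<lambda>k. \<integral>z. min (H k z) (?GT z) \<partial>P) \<longlonglongrightarrow> (\<integral>z. ?GT z \<partial>P)"
  proof (rule integral_dominated_convergence[rotated 3])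
    show "AE z in P. norm (min (H k z) (?GT z)) \<le> \<bar>?GT z\<bar> + \<bar>\<tau>\<bar>" for k
      using AE_space
    proof eventually_elim
      case (elim z)
      then have "\<tau> \<le> H k z" using H_ge borel_prob_on_space[OF P] by simp
      then have "\<tau> \<le> min (H k z) (?GT z)" "min (H k z) (?GT z) \<le> ?GT z" by auto
      then show ?case unfolding real_norm_def by linarith
    qed
    show "integrable P (\<lambda>z. \<bar>?GT z\<bar> + \<bar>\<tau>\<bar>)" using GT by simp
    show "(\<lambda>z. min (H k z) (?GT z)) \<in> borel_measurable P" for k using H[OF P] GT by simp
  qed (use GT in simp)
  moreover have "c + e < (\<integral>z. ?GT z \<partial>P)"
  proof -
    have "c + e < integral\<^sup>L P ?G" using c by (simp add: e_def field_simps)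
    also have "\<dots> \<le> (\<integral>z. ?GT z \<partial>P)" using G GT by (intro integral_mono) auto
    finally show ?thesis .
  qed
  ultimately have "eventually (\<lambda>k. c + e < (\<integral>z. min (H k z) (?GT z) \<partial>P)) sequentially"
    by (rule order_tendstoD(1))
  then obtain K where "c + e < (\<integral>z. min (H K z) (?GT z) \<partial>P)"
    unfolding eventually_sequentially by blast
  also have "\<dots> \<le> integral\<^sup>L P (H K)" using H[OF P] GT by (intro integral_mono) auto
  finally have K: "c + e < integral\<^sup>L P (H K)" .
  have "(\<lambda>\<nu>. integral\<^sup>L (Pn \<nu>) (H K)) \<longlonglongrightarrow> integral\<^sup>L P (H K)"
    using weak \<tau> unfolding weak_conv_on_def H_def
    by (simp add: continuous_on_lipschitz_minorant bounded_lipschitz_minorant)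
  then have "eventually (\<lambda>\<nu>. c + e < integral\<^sup>L (Pn \<nu>) (H K)) sequentially"
    using K by (rule order_tendstoD(1))
  then show "eventually (\<lambda>\<nu>. c' < ereal_expectation (Pn \<nu>) (gn \<nu>)) sequentially"
    using ev eventually_ge_at_top[of K]
  proof eventually_elim
    case (elim \<nu>)
    let ?g = "\<lambda>z. real_of_ereal (gn \<nu> z)"
    let ?t = "\<lambda>z. gn \<nu> z * of_bool (gn \<nu> z \<le> ereal \<tau>)"
    have [measurable]: "gn \<nu> \<in> borel_measurable (Pn \<nu>)" using gn by (simp add: ereal_integrable_def)
    have t: "ereal_integrable (Pn \<nu>) ?t"
      by (rule ereal_integrable_truncate[OF gn]) measurable
    \<comment> \<open>Since \<open>\<tau> < 0\<close>, truncating at \<open>\<tau>\<close> and adding the tail never exceeds the original function.\<close>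
    have "integral\<^sup>L (Pn \<nu>) (H K) + (\<integral>z. real_of_ereal (?t z) \<partial>Pn \<nu>)
        = (\<integral>z. H K z + real_of_ereal (?t z) \<partial>Pn \<nu>)"
      using H[OF Pn] integrable_real_of_ereal[OF t] by simp
    also have "\<dots> \<le> (\<integral>z. ?g z \<partial>Pn \<nu>)"
    proof (rule integral_mono_AE)
      show "AE z in Pn \<nu>. H K z + real_of_ereal (?t z) \<le> ?g z"
        using ereal_integrable_AE_finite[OF gn] AE_space
      proof eventually_elim
        case (elim z)
        then have z: "z \<in> Z" using borel_prob_on_space[OF Pn] by simp
        obtain r where r: "gn \<nu> z = ereal r" using elim by metis
        have "H K z \<le> clamp_real \<tau> K (ereal r)"
          unfolding H_def r[symmetric] using \<tau> z \<open>K \<le> \<nu>\<close> by (intro lipschitz_minorant_le) auto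
        also have "\<dots> \<le> max \<tau> r" by (simp add: clamp_real_def max_def min_def)
        finally show ?case using \<tau> by (auto simp: r max_def split: if_splits)
      qed
    qed (use H[OF Pn] integrable_real_of_ereal[OF t] integrable_real_of_ereal[OF gn] in auto)
    finally have "c < (\<integral>z. ?g z \<partial>Pn \<nu>)"
      using elim unfolding ereal_expectation_eq_integral[OF t] by simp
    then show ?case
      unfolding ereal_expectation_eq_integral[OF gn] using c(1)
      by (metis less_ereal.simps(1) less_trans)
  qed
qed

text \<open>For a given tolerance the iterated lower limit supplies one truncation level, and the joint
lower limit at that level bounds the tails along any sequence of points. This is the form of tail
control that Fatou's lemma for varying measures uses.\<close>

lemma lower_tail_along_sequence:
  fixes E :: "real \<Rightarrow> nat \<Rightarrow> 'a::topological_space \<Rightarrow> ereal"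
  assumes tail: "Liminf at_bot (\<lambda>\<tau>. Liminf (joint_filter X x) (\<lambda>(\<nu>, x). E \<tau> \<nu> x)) = 0"
    and s: "\<And>\<nu>. s \<nu> \<in> X" "s \<longlonglongrightarrow> x" and \<epsilon>: "\<epsilon> > 0"
  shows "\<exists>\<tau><0. eventually (\<lambda>\<nu>. - ereal \<epsilon> < E \<tau> \<nu> (s \<nu>)) sequentially"
proof -
  have "- ereal \<epsilon> < Liminf at_bot (\<lambda>\<tau>. Liminf (joint_filter X x) (\<lambda>(\<nu>, x). E \<tau> \<nu> x))"
    using \<epsilon> by (simp add: tail)
  from less_LiminfD[OF this] eventually_gt_at_bot[of "0::real"]
  have "eventually (\<lambda>\<tau>. \<tau> < 0 \<and> - ereal \<epsilon> < joint_liminf X (E \<tau>) x) at_bot"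
    unfolding joint_liminf_def by eventually_elim auto
  then obtain \<tau> where \<tau>: "\<tau> < 0" "- ereal \<epsilon> < joint_liminf X (E \<tau>) x"
    by (auto simp: eventually_at_bot_linorder)
  note \<tau>(2)
  also have "joint_liminf X (E \<tau>) x \<le> liminf (\<lambda>\<nu>. E \<tau> \<nu> (s \<nu>))"
    by (rule joint_liminf_le_Liminf) (use s in \<open>auto simp: filterlim_ident\<close>)
  finally show ?thesis using \<tau>(1) less_LiminfD by blast
qed

text \<open>The sign changes turn the upper tail of a function above \<open>- \<tau>\<close> into the lower tail of its
negative below \<open>\<tau>\<close>.\<close>

lemma upper_tail_negated:
  fixes E :: "real \<Rightarrow> nat \<Rightarrow> ereal"
  assumes tail: "Limsup at_top (\<lambda>\<tau>. limsup (E \<tau>)) = 0" and \<epsilon>: "\<epsilon> > 0"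
  shows "\<exists>\<tau><0. eventually (\<lambda>\<nu>. - ereal \<epsilon> < - E (- \<tau>) \<nu>) sequentially"
proof -
  have "Limsup at_top (\<lambda>\<tau>. limsup (E \<tau>)) < ereal \<epsilon>" using \<epsilon> by (simp add: tail)
  from Limsup_lessD[OF this] eventually_gt_at_top[of "0::real"]
  have "eventually (\<lambda>\<tau>. \<tau> > 0 \<and> limsup (E \<tau>) < ereal \<epsilon>) at_top"
    by eventually_elim auto
  then obtain \<tau> where "\<tau> > 0" "limsup (E \<tau>) < ereal \<epsilon>"
    by (auto simp: eventually_at_top_linorder)
  then show ?thesis
    by (intro exI[of _ "- \<tau>"]) (auto dest!: Limsup_lessD simp del: uminus_ereal.simps)
qed

lemma tendsto_of_liminf_limsup:
  fixes e :: "nat \<Rightarrow> ereal"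
  assumes "L \<le> liminf e" "limsup e \<le> L"
  shows "e \<longlonglongrightarrow> L"
proof -
  have "liminf e \<le> limsup e" by (rule Liminf_le_Limsup) simp
  with assms have "liminf e = L" "limsup e = L" by (auto intro: antisym)
  then show ?thesis by (simp add: tendsto_iff_Liminf_eq_Limsup)
qed

text \<open>The lower estimate applies Fatou's lemma for varying measures along an arbitrary sequence of
points \<open>s \<nu>\<close> converging to \<open>x\<close>, using the lower tail condition and equi-lower semicontinuity. The matching upper
estimate at fixed \<open>x\<close> is the same lemma applied to the negated integrands, where the upper tail
condition and equi-upper semicontinuity take over.\<close>

lemma expectation_limits:
  fixes X :: "'a::real_normed_vector set" and \<Xi> :: "'b::real_normed_vector set"
  assumes P: "borel_prob_on \<Xi> P" and Pn: "\<And>\<nu>. borel_prob_on \<Xi> (Pn \<nu>)"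
    and weak: "weak_conv_on \<Xi> Pn P"
    and g: "\<And>x. x \<in> X \<Longrightarrow> ereal_integrable P (\<lambda>\<xi>. g (x, \<xi>))"
    and gn: "\<And>\<nu> x. x \<in> X \<Longrightarrow> ereal_integrable (Pn \<nu>) (\<lambda>\<xi>. gn \<nu> (x, \<xi>))"
    and fin: "\<And>x \<xi>. x \<in> X \<Longrightarrow> \<xi> \<in> \<Xi> \<Longrightarrow> \<bar>g (x, \<xi>)\<bar> \<noteq> \<infinity>"
    and ptw: "pointwise_conv (X \<times> \<Xi>) gn g"
    and lsc: "equi_lsc (X \<times> \<Xi>) gn"
    and usc: "\<And>x. x \<in> X \<Longrightarrow> equi_usc \<Xi> (\<lambda>\<nu> \<xi>. gn \<nu> (x, \<xi>))"
    and lower_tail: "\<And>x. x \<in> X \<Longrightarrow>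
      Liminf at_bot (\<lambda>\<tau>::real. Liminf (joint_filter X x) (\<lambda>(\<nu>, x).
        ereal_expectation (Pn \<nu>) (\<lambda>\<xi>. gn \<nu> (x, \<xi>) * of_bool (gn \<nu> (x, \<xi>) \<le> ereal \<tau>)))) = 0"
    and upper_tail: "\<And>x. x \<in> X \<Longrightarrow>
      Limsup at_top (\<lambda>\<tau>::real. limsup (\<lambda>\<nu>.
        ereal_expectation (Pn \<nu>) (\<lambda>\<xi>. gn \<nu> (x, \<xi>) * of_bool (gn \<nu> (x, \<xi>) \<ge> ereal \<tau>)))) = 0"
    and x: "x \<in> X"
  shows expectation_le_joint_liminf:
      "ereal_expectation P (\<lambda>\<xi>. g (x, \<xi>))
        \<le> joint_liminf X (\<lambda>\<nu> x. ereal_expectation (Pn \<nu>) (\<lambda>\<xi>. gn \<nu> (x, \<xi>))) x" (is ?lower)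
    and expectation_tendsto:
      "(\<lambda>\<nu>. ereal_expectation (Pn \<nu>) (\<lambda>\<xi>. gn \<nu> (x, \<xi>)))
        \<longlonglongrightarrow> ereal_expectation P (\<lambda>\<xi>. g (x, \<xi>))" (is ?lim)
proof -
  have lim: "(\<lambda>\<nu>. gn \<nu> (x, \<xi>)) \<longlonglongrightarrow> g (x, \<xi>)" if "\<xi> \<in> \<Xi>" for \<xi>
    using ptw x that by (auto simp: pointwise_conv_def)
  have seq: "ereal_expectation P (\<lambda>\<xi>. g (x, \<xi>))
      \<le> liminf (\<lambda>\<nu>. ereal_expectation (Pn \<nu>) (\<lambda>\<xi>. gn \<nu> (s \<nu>, \<xi>)))"
    if s: "\<And>\<nu>. s \<nu> \<in> X" "s \<longlonglongrightarrow> x" for s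
  proof (rule fatou_weak_conv[OF P Pn weak g[OF x] gn[OF s(1)]])
    fix \<xi> assume \<xi>: "\<xi> \<in> \<Xi>"
    have "g (x, \<xi>) \<le> joint_liminf (X \<times> \<Xi>) gn (x, \<xi>)"
      by (rule equi_lsc_imp_le_joint_liminf[OF lsc _ lim[OF \<xi>]]) (use fin[OF x \<xi>] x \<xi> in auto)
    also have "\<dots> \<le> joint_liminf \<Xi> (\<lambda>\<nu> \<xi>. gn \<nu> (s \<nu>, \<xi>)) \<xi>"
      by (rule joint_liminf_compose)
        (use s in \<open>auto intro!: tendsto_Pair tendsto_snd_joint_filter
          filterlim_compose[OF s(2) filterlim_fst_joint_filter]\<close>)
    finally show "g (x, \<xi>) \<le> joint_liminf \<Xi> (\<lambda>\<nu> \<xi>. gn \<nu> (s \<nu>, \<xi>)) \<xi>" .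
  next
    fix \<epsilon> :: real assume "\<epsilon> > 0"
    then show "\<exists>\<tau><0. eventually (\<lambda>\<nu>. - ereal \<epsilon> < ereal_expectation (Pn \<nu>)
        (\<lambda>\<xi>. gn \<nu> (s \<nu>, \<xi>) * of_bool (gn \<nu> (s \<nu>, \<xi>) \<le> ereal \<tau>))) sequentially"
      by (rule lower_tail_along_sequence[OF lower_tail[OF x] s])
  qed
  show ?lower using x seq by (rule sequential_liminf_imp_joint)
  have "ereal_expectation P (\<lambda>\<xi>. - g (x, \<xi>))
      \<le> liminf (\<lambda>\<nu>. ereal_expectation (Pn \<nu>) (\<lambda>\<xi>. - gn \<nu> (x, \<xi>)))"
  proof (rule fatou_weak_conv[OF P Pn weak ereal_integrable_uminus[OF g[OF x]]
        ereal_integrable_uminus[OF gn[OF x]]])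
    fix \<xi> assume \<xi>: "\<xi> \<in> \<Xi>"
    have "- g (x, \<xi>) \<le> joint_liminf \<Xi> (\<lambda>\<nu>. \<lambda>\<xi>\<in>\<Xi>. - gn \<nu> (x, \<xi>)) \<xi>"
    proof (rule equi_lsc_imp_le_joint_liminf)
      show "equi_lsc \<Xi> (\<lambda>\<nu>. \<lambda>\<xi>\<in>\<Xi>. - gn \<nu> (x, \<xi>))" using usc[OF x] by (simp add: equi_usc_def)
      show "(\<lambda>\<nu>. (\<lambda>\<xi>\<in>\<Xi>. - gn \<nu> (x, \<xi>)) \<xi>) \<longlonglongrightarrow> - g (x, \<xi>)"
        using lim[OF \<xi>] \<xi> by (simp add: tendsto_uminus_ereal)
      show "- g (x, \<xi>) \<noteq> - \<infinity>" using fin[OF x \<xi>] by auto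
    qed (rule \<xi>)
    also have "\<dots> \<le> joint_liminf \<Xi> (\<lambda>\<nu> \<xi>. - gn \<nu> (x, \<xi>)) \<xi>"
      by (rule joint_liminf_mono) simp
    finally show "- g (x, \<xi>) \<le> joint_liminf \<Xi> (\<lambda>\<nu> \<xi>. - gn \<nu> (x, \<xi>)) \<xi>" .
  next
    fix \<epsilon> :: real assume "\<epsilon> > 0"
    from upper_tail_negated[OF upper_tail[OF x] this] obtain \<tau> where \<tau>: "\<tau> < 0"
      and ev: "eventually (\<lambda>\<nu>. - ereal \<epsilon> < - ereal_expectation (Pn \<nu>)
        (\<lambda>\<xi>. gn \<nu> (x, \<xi>) * of_bool (gn \<nu> (x, \<xi>) \<ge> ereal (- \<tau>)))) sequentially" by blast
    have "- ereal_expectation (Pn \<nu>) (\<lambda>\<xi>. gn \<nu> (x, \<xi>) * of_bool (gn \<nu> (x, \<xi>) \<ge> ereal (- \<tau>)))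
      = ereal_expectation (Pn \<nu>) (\<lambda>\<xi>. - gn \<nu> (x, \<xi>) * of_bool (- gn \<nu> (x, \<xi>) \<le> ereal \<tau>))" for \<nu>
    proof -
      have [measurable]: "(\<lambda>\<xi>. gn \<nu> (x, \<xi>)) \<in> borel_measurable (Pn \<nu>)"
        using gn[OF x] by (simp add: ereal_integrable_def)
      have "ereal_integrable (Pn \<nu>) (\<lambda>\<xi>. gn \<nu> (x, \<xi>) * of_bool (gn \<nu> (x, \<xi>) \<ge> ereal (- \<tau>)))"
        by (rule ereal_integrable_truncate[OF gn[OF x]]) measurable
      from ereal_expectation_uminus[OF this] show ?thesis
        by (simp add: ereal_uminus_le_reorder)
    qed
    with \<tau> ev show "\<exists>\<tau><0. eventually (\<lambda>\<nu>. - ereal \<epsilon> < ereal_expectation (Pn \<nu>)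
        (\<lambda>\<xi>. - gn \<nu> (x, \<xi>) * of_bool (- gn \<nu> (x, \<xi>) \<le> ereal \<tau>))) sequentially"
      by auto
  qed
  then have "limsup (\<lambda>\<nu>. ereal_expectation (Pn \<nu>) (\<lambda>\<xi>. gn \<nu> (x, \<xi>)))
      \<le> ereal_expectation P (\<lambda>\<xi>. g (x, \<xi>))"
    using g[OF x] gn[OF x] by (simp add: ereal_expectation_uminus ereal_Liminf_uminus)
  moreover have "ereal_expectation P (\<lambda>\<xi>. g (x, \<xi>))
      \<le> liminf (\<lambda>\<nu>. ereal_expectation (Pn \<nu>) (\<lambda>\<xi>. gn \<nu> (x, \<xi>)))"
    by (rule seq) (use x in auto)
  ultimately show ?lim by (rule tendsto_of_liminf_limsup[rotated])
qed

section \<open>The Bellman recursion\<close>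

text \<open>Both modes of convergence are inherited by the objective because \<open>W\<close> is finite, so that
the sum of the limits is never indeterminate.\<close>

lemma bellman_objective_limits:
  fixes X :: "'a::metric_space set" and \<Xi> :: "'b::metric_space set"
  assumes \<beta>: "0 < \<beta>" and K: "K \<subseteq> X" and x: "x \<in> X" "\<xi> \<in> \<Xi>"
    and epi: "epi_conv (X \<times> X \<times> \<Xi>) (\<lambda>\<nu> z. ereal (\<phi>n \<nu> z)) (\<lambda>z. ereal (\<phi> z))"
    and ptw: "pointwise_conv (X \<times> X \<times> \<Xi>) (\<lambda>\<nu> z. ereal (\<phi>n \<nu> z)) (\<lambda>z. ereal (\<phi> z))"
    and W: "\<And>y. y \<in> X \<Longrightarrow> \<bar>W y\<bar> \<noteq> \<infinity>"
    and Wn: "pointwise_conv X Wn W"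
    and lower: "\<And>y. y \<in> X \<Longrightarrow> W y \<le> joint_liminf X Wn y"
    and y: "y \<in> K"
  shows bellman_objective_tendsto:
      "(\<lambda>\<nu>. bellman_objective (\<phi>n \<nu>) \<beta> (Wn \<nu>) x \<xi> y) \<longlonglongrightarrow> bellman_objective \<phi> \<beta> W x \<xi> y"
    and bellman_objective_le_joint_liminf:
      "bellman_objective \<phi> \<beta> W x \<xi> y
        \<le> joint_liminf K (\<lambda>\<nu>. bellman_objective (\<phi>n \<nu>) \<beta> (Wn \<nu>) x \<xi>) y"
proof -
  have yX: "y \<in> X" using K y by blast
  obtain q where q: "W y = ereal q" using W[OF yX] by auto
  have "(\<lambda>\<nu>. ereal (\<phi>n \<nu> (x, y, \<xi>))) \<longlonglongrightarrow> ereal (\<phi> (x, y, \<xi>))"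
    using ptw x yX by (auto simp: pointwise_conv_def)
  moreover have "(\<lambda>\<nu>. ereal \<beta> * Wn \<nu> y) \<longlonglongrightarrow> ereal \<beta> * W y"
    using Wn yX by (intro tendsto_cmult_ereal) (auto simp: pointwise_conv_def)
  ultimately show "(\<lambda>\<nu>. bellman_objective (\<phi>n \<nu>) \<beta> (Wn \<nu>) x \<xi> y)
      \<longlonglongrightarrow> bellman_objective \<phi> \<beta> W x \<xi> y"
    unfolding bellman_objective_def q by (intro tendsto_add_ereal) auto
  have "ereal (\<phi> (x, y, \<xi>)) \<le> joint_liminf (X \<times> X \<times> \<Xi>) (\<lambda>\<nu> z. ereal (\<phi>n \<nu> z)) (x, y, \<xi>)"
    using epi by (rule epi_conv_imp_le_joint_liminf) (use x yX in auto)
  also have "\<dots> \<le> joint_liminf K (\<lambda>\<nu> y. ereal (\<phi>n \<nu> (x, y, \<xi>))) y"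
    by (rule joint_liminf_compose)
      (use K x in \<open>auto intro!: tendsto_intros tendsto_snd_joint_filter\<close>)
  finally have p: "ereal (\<phi> (x, y, \<xi>)) \<le> joint_liminf K (\<lambda>\<nu> y. ereal (\<phi>n \<nu> (x, y, \<xi>))) y" .
  have "ereal q \<le> joint_liminf X Wn y" using lower[OF yX] by (simp add: q)
  also have "\<dots> \<le> joint_liminf K (\<lambda>\<nu> y. Wn \<nu> y) y"
    by (rule joint_liminf_compose) (use K in \<open>auto intro!: tendsto_snd_joint_filter\<close>)
  finally have "ereal q \<le> joint_liminf K Wn y" .
  from Liminf_add_scaled[OF \<beta> p[unfolded joint_liminf_def case_prod_beta']
      this[unfolded joint_liminf_def case_prod_beta']]
  show "bellman_objective \<phi> \<beta> W x \<xi> y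
        \<le> joint_liminf K (\<lambda>\<nu>. bellman_objective (\<phi>n \<nu>) \<beta> (Wn \<nu>) x \<xi>) y"
    by (simp add: joint_liminf_def bellman_objective_def q case_prod_beta')
qed

text \<open>For fixed \<open>x\<close> and \<open>\<xi>\<close> the Bellman operator minimises over a compact set, so
that the infima converge, the limiting problem has a solution, and limits of minimisers are minimisers. Its value
is finite because it is attained and \<open>W\<close> is finite.\<close>

lemma bellman_b_limits:
  fixes X :: "'a::metric_space set" and \<Xi> :: "'b::metric_space set"
  assumes \<beta>: "0 < \<beta>" and x: "x \<in> X" "\<xi> \<in> \<Xi>"
    and Y: "Y (x, \<xi>) \<noteq> {}" "compact (Y (x, \<xi>))" "Y (x, \<xi>) \<subseteq> X"
    and epi: "epi_conv (X \<times> X \<times> \<Xi>) (\<lambda>\<nu> z. ereal (\<phi>n \<nu> z)) (\<lambda>z. ereal (\<phi> z))"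
    and ptw: "pointwise_conv (X \<times> X \<times> \<Xi>) (\<lambda>\<nu> z. ereal (\<phi>n \<nu> z)) (\<lambda>z. ereal (\<phi> z))"
    and W: "\<And>y. y \<in> X \<Longrightarrow> \<bar>W y\<bar> \<noteq> \<infinity>"
    and Wn: "pointwise_conv X Wn W"
    and lower: "\<And>y. y \<in> X \<Longrightarrow> W y \<le> joint_liminf X Wn y"
  shows bellman_b_tendsto:
      "(\<lambda>\<nu>. bellman_b X \<Xi> Y \<beta> (\<phi>n \<nu>) (Wn \<nu>) (x, \<xi>)) \<longlonglongrightarrow> bellman_b X \<Xi> Y \<beta> \<phi> W (x, \<xi>)"
    and bellman_b_finite: "\<bar>bellman_b X \<Xi> Y \<beta> \<phi> W (x, \<xi>)\<bar> \<noteq> \<infinity>"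
    and LimOut_argmin_bellman_objective:
      "LimOut (\<lambda>\<nu>. argmin_on (Y (x, \<xi>)) (bellman_objective (\<phi>n \<nu>) \<beta> (Wn \<nu>) x \<xi>))
        \<subseteq> argmin_on (Y (x, \<xi>)) (bellman_objective \<phi> \<beta> W x \<xi>)"
    and argmin_bellman_objective_nonempty:
      "argmin_on (Y (x, \<xi>)) (bellman_objective \<phi> \<beta> W x \<xi>) \<noteq> {}"
proof -
  note obj = bellman_objective_tendsto[where X = X and \<Xi> = \<Xi>, OF \<beta> Y(3) x epi ptw W Wn lower]
    bellman_objective_le_joint_liminf[where X = X and \<Xi> = \<Xi>, OF \<beta> Y(3) x epi ptw W Wn lower]
  let ?h = "bellman_objective \<phi> \<beta> W x \<xi>"
  have b: "bellman_b X \<Xi> Y \<beta> \<psi> U (x, \<xi>) = (INF y\<in>Y (x, \<xi>). bellman_objective \<psi> \<beta> U x \<xi> y)" for \<psi> U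
    using x by (simp add: bellman_b_def)
  show "(\<lambda>\<nu>. bellman_b X \<Xi> Y \<beta> (\<phi>n \<nu>) (Wn \<nu>) (x, \<xi>)) \<longlonglongrightarrow> bellman_b X \<Xi> Y \<beta> \<phi> W (x, \<xi>)"
    unfolding b using Y(2) obj by (rule INF_tendsto_compact)
  obtain y where y: "y \<in> Y (x, \<xi>)" "?h y = (INF y\<in>Y (x, \<xi>). ?h y)"
    using Y(2,1) obj by (rule compact_limit_attains_INF)
  have "y \<in> X" using y(1) Y(3) by blast
  then obtain q where "W y = ereal q" using W[of y] by auto
  then show "\<bar>bellman_b X \<Xi> Y \<beta> \<phi> W (x, \<xi>)\<bar> \<noteq> \<infinity>"
    unfolding b y(2)[symmetric] by (simp add: bellman_objective_def)
  have "y \<in> argmin_on (Y (x, \<xi>)) ?h"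
    using y by (auto simp: argmin_on_def is_arg_min_linorder intro: INF_lower)
  then show "argmin_on (Y (x, \<xi>)) ?h \<noteq> {}" by blast
  show "LimOut (\<lambda>\<nu>. argmin_on (Y (x, \<xi>)) (bellman_objective (\<phi>n \<nu>) \<beta> (Wn \<nu>) x \<xi>))
      \<subseteq> argmin_on (Y (x, \<xi>)) ?h"
    using compact_imp_closed[OF Y(2)] obj by (rule LimOut_argmin_subset)
qed

theorem theorem1:
  fixes X :: "(real ^ 'n) set"
    and \<Xi> :: "(real ^ 'm) set"
    and Y :: "(real ^ 'n) \<times> (real ^ 'm) \<Rightarrow> (real ^ 'n) set"
    and \<beta> :: real
    and \<phi> :: "(real ^ 'n) \<times> (real ^ 'n) \<times> (real ^ 'm) \<Rightarrow> real"
    and \<phi>n :: "nat \<Rightarrow> (real ^ 'n) \<times> (real ^ 'n) \<times> (real ^ 'm) \<Rightarrow> real"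
    and P :: "(real ^ 'm) measure"
    and Pn :: "nat \<Rightarrow> (real ^ 'm) measure"
    and T :: nat
    and \<V> :: "((real ^ 'n) \<Rightarrow> ereal) set"
    and V :: "nat \<Rightarrow> (real ^ 'n) \<Rightarrow> ereal"
    and Vn :: "nat \<Rightarrow> nat \<Rightarrow> (real ^ 'n) \<Rightarrow> ereal"
  defines "b \<equiv> bellman_b X \<Xi> Y \<beta> \<phi>"
    and "bn \<equiv> \<lambda>\<nu>. bellman_b X \<Xi> Y \<beta> (\<phi>n \<nu>)"
    and "B \<equiv> bellman_B X \<Xi> Y \<beta> \<phi> P"
    and "Bn \<equiv> \<lambda>\<nu>. bellman_B X \<Xi> Y \<beta> (\<phi>n \<nu>) (Pn \<nu>)"
  assumes "closed X" and "closed \<Xi>"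
    and "0 < \<beta>" and "\<beta> < 1"
    and "\<And>x \<xi>. x \<in> X \<Longrightarrow> \<xi> \<in> \<Xi> \<Longrightarrow> Y (x, \<xi>) \<noteq> {} \<and> compact (Y (x, \<xi>)) \<and> Y (x, \<xi>) \<subseteq> X"
    and "borel_prob_on \<Xi> P" and "\<And>\<nu>. borel_prob_on \<Xi> (Pn \<nu>)"
    and "\<V> \<subseteq> lsc_fcns X" and "(\<lambda>x\<in>X. 0) \<in> \<V>"
    and "\<And>W x. W \<in> \<V> \<Longrightarrow> x \<in> X \<Longrightarrow> ereal_integrable P (\<lambda>\<xi>. b W (x, \<xi>))"
    and "\<And>W. W \<in> \<V> \<Longrightarrow> B W \<in> \<V>"
    and "\<And>\<nu> W x. W \<in> \<V> \<Longrightarrow> x \<in> X \<Longrightarrow> ereal_integrable (Pn \<nu>) (\<lambda>\<xi>. bn \<nu> W (x, \<xi>))"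
    and "\<And>\<nu> W. W \<in> \<V> \<Longrightarrow> Bn \<nu> W \<in> \<V>"
    and "weak_conv_on \<Xi> Pn P"
    and "epi_conv (X \<times> X \<times> \<Xi>) (\<lambda>\<nu> z. ereal (\<phi>n \<nu> z)) (\<lambda>z. ereal (\<phi> z))"
    and "pointwise_conv (X \<times> X \<times> \<Xi>) (\<lambda>\<nu> z. ereal (\<phi>n \<nu> z)) (\<lambda>z. ereal (\<phi> z))"
    and "V (T + 1) = (\<lambda>x\<in>X. 0)" and "\<And>t. t \<in> {1..T} \<Longrightarrow> V t = B (V (t + 1))"
    and "\<And>\<nu>. Vn \<nu> (T + 1) = (\<lambda>x\<in>X. 0)"
    and "\<And>\<nu> t. t \<in> {1..T} \<Longrightarrow> Vn \<nu> t = Bn \<nu> (Vn \<nu> (t + 1))"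
    and "\<And>t. t \<in> {1..T} \<Longrightarrow> equi_lsc X (\<lambda>\<nu>. Vn \<nu> (t + 1))"
    and lower_tail: "\<And>t x0. t \<in> {1..T} \<Longrightarrow> x0 \<in> X \<Longrightarrow>
      Liminf at_bot (\<lambda>\<tau>::real.
        Liminf (sequentially \<times>\<^sub>F inf (nhds x0) (principal X)) (\<lambda>(\<nu>, x).
          ereal_expectation (Pn \<nu>) (\<lambda>\<xi>. bn \<nu> (Vn \<nu> (t + 1)) (x, \<xi>) *
            of_bool (bn \<nu> (Vn \<nu> (t + 1)) (x, \<xi>) \<le> ereal \<tau>)))) = 0"
    and "\<And>t. t \<in> {1..T} \<Longrightarrow> equi_lsc (X \<times> \<Xi>) (\<lambda>\<nu>. bn \<nu> (Vn \<nu> (t + 1)))"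
    and upper_tail: "\<And>t x0. t \<in> {1..T} \<Longrightarrow> x0 \<in> X \<Longrightarrow>
      Limsup at_top (\<lambda>\<tau>::real.
        limsup (\<lambda>\<nu>.
          ereal_expectation (Pn \<nu>) (\<lambda>\<xi>. bn \<nu> (Vn \<nu> (t + 1)) (x0, \<xi>) *
            of_bool (bn \<nu> (Vn \<nu> (t + 1)) (x0, \<xi>) \<ge> ereal \<tau>)))) = 0"
    and "\<And>t x0. t \<in> {1..T} \<Longrightarrow> x0 \<in> X \<Longrightarrow>
      equi_usc \<Xi> (\<lambda>\<nu> \<xi>. bn \<nu> (Vn \<nu> (t + 1)) (x0, \<xi>))"
  shows "\<forall>t\<in>{1..T}. epi_conv X (\<lambda>\<nu>. Vn \<nu> (t + 1)) (V (t + 1)) \<and>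
    (\<forall>x\<in>X. \<forall>\<xi>\<in>\<Xi>.
      LimOut (\<lambda>\<nu>. argmin_on (Y (x, \<xi>)) (bellman_objective (\<phi>n \<nu>) \<beta> (Vn \<nu> (t + 1)) x \<xi>))
        \<subseteq> argmin_on (Y (x, \<xi>)) (bellman_objective \<phi> \<beta> (V (t + 1)) x \<xi>) \<and>
      argmin_on (Y (x, \<xi>)) (bellman_objective \<phi> \<beta> (V (t + 1)) x \<xi>) \<noteq> {})"
proof -
  note Y = assms(9) and P = assms(10) and Pn = assms(11) and zero = assms(13)
    and intb = assms(14) and mapB = assms(15) and intbn = assms(16) and mapBn = assms(17)
    and weak = assms(18) and epi = assms(19) and ptw = assms(20)
    and VT = assms(21) and Vt = assms(22) and VnT = assms(23) and Vnt = assms(24)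
    and lsc = assms(27) and usc = assms(29)
  define stage where "stage t \<longleftrightarrow> V t \<in> \<V> \<and> (\<forall>\<nu>. Vn \<nu> t \<in> \<V>) \<and> (\<forall>x\<in>X. \<bar>V t x\<bar> \<noteq> \<infinity>) \<and>
    pointwise_conv X (\<lambda>\<nu>. Vn \<nu> t) (V t) \<and> (\<forall>x\<in>X. V t x \<le> joint_liminf X (\<lambda>\<nu>. Vn \<nu> t) x)" for t
  have last: "stage (T + 1)"
    unfolding stage_def VT VnT pointwise_conv_def
    by (intro conjI allI ballI zero) (auto intro!: le_joint_liminfI exI[of _ UNIV])
  have step: "stage t" if t: "t \<in> {1..T}" and "stage (t + 1)" for t
  proof -
    have S: "V (t + 1) \<in> \<V>" "\<And>\<nu>. Vn \<nu> (t + 1) \<in> \<V>" "\<And>x. x \<in> X \<Longrightarrow> \<bar>V (t + 1) x\<bar> \<noteq> \<infinity>"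
      "pointwise_conv X (\<lambda>\<nu>. Vn \<nu> (t + 1)) (V (t + 1))"
      "\<And>x. x \<in> X \<Longrightarrow> V (t + 1) x \<le> joint_liminf X (\<lambda>\<nu>. Vn \<nu> (t + 1)) x"
      using \<open>stage (t + 1)\<close> by (auto simp: stage_def)
    have b: "(\<lambda>\<nu>. bn \<nu> (Vn \<nu> (t + 1)) (x, \<xi>)) \<longlonglongrightarrow> b (V (t + 1)) (x, \<xi>)"
      "\<bar>b (V (t + 1)) (x, \<xi>)\<bar> \<noteq> \<infinity>" if "x \<in> X" "\<xi> \<in> \<Xi>" for x \<xi>
      unfolding b_def bn_def
      using bellman_b_tendsto[where X = X and \<Xi> = \<Xi> and Y = Y, OF \<open>0 < \<beta>\<close> that _ _ _ epi ptw S(3-5)]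
        bellman_b_finite[where X = X and \<Xi> = \<Xi> and Y = Y, OF \<open>0 < \<beta>\<close> that _ _ _ epi ptw S(3-5)]
        Y[OF that] by auto
    have bptw: "pointwise_conv (X \<times> \<Xi>) (\<lambda>\<nu>. bn \<nu> (Vn \<nu> (t + 1))) (b (V (t + 1)))"
      using b(1) by (auto simp: pointwise_conv_def)
    have le: "ereal_expectation P (\<lambda>\<xi>. b (V (t + 1)) (x, \<xi>))
        \<le> joint_liminf X (\<lambda>\<nu> x. ereal_expectation (Pn \<nu>) (\<lambda>\<xi>. bn \<nu> (Vn \<nu> (t + 1)) (x, \<xi>))) x"
      if "x \<in> X" for x
      by (rule expectation_le_joint_liminf[OF P Pn weak intb[OF S(1)] intbn[OF S(2)] b(2) bptw
            lsc[OF t] usc[OF t] lower_tail[OF t, folded joint_filter_def] upper_tail[OF t] that])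
    have lim: "(\<lambda>\<nu>. ereal_expectation (Pn \<nu>) (\<lambda>\<xi>. bn \<nu> (Vn \<nu> (t + 1)) (x, \<xi>)))
        \<longlonglongrightarrow> ereal_expectation P (\<lambda>\<xi>. b (V (t + 1)) (x, \<xi>))" if "x \<in> X" for x
      by (rule expectation_tendsto[OF P Pn weak intb[OF S(1)] intbn[OF S(2)] b(2) bptw
            lsc[OF t] usc[OF t] lower_tail[OF t, folded joint_filter_def] upper_tail[OF t] that])
    have V: "V t x = ereal_expectation P (\<lambda>\<xi>. b (V (t + 1)) (x, \<xi>))" if "x \<in> X" for x
      using that by (simp add: Vt[OF t] B_def bellman_B_def b_def)
    have Vn: "Vn \<nu> t x = ereal_expectation (Pn \<nu>) (\<lambda>\<xi>. bn \<nu> (Vn \<nu> (t + 1)) (x, \<xi>))"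
      if "x \<in> X" for x \<nu>
      using that by (simp add: Vnt[OF t] Bn_def bellman_B_def bn_def)
    show "stage t"
      unfolding stage_def
    proof (intro conjI allI ballI)
      show "V t \<in> \<V>" unfolding Vt[OF t] by (rule mapB) (rule S)
      show "Vn \<nu> t \<in> \<V>" for \<nu> unfolding Vnt[OF t] by (rule mapBn) (rule S)
      show "pointwise_conv X (\<lambda>\<nu>. Vn \<nu> t) (V t)"
        using lim by (simp add: pointwise_conv_def V Vn)
      fix x assume x: "x \<in> X"
      show "\<bar>V t x\<bar> \<noteq> \<infinity>"
        using ereal_expectation_eq_integral[OF intb[OF S(1) x]] by (simp add: V[OF x])
      have "V t x \<le> joint_liminf X (\<lambda>\<nu> x. ereal_expectation (Pn \<nu>) (\<lambda>\<xi>. bn \<nu> (Vn \<nu> (t + 1)) (x, \<xi>))) x"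
        using le[OF x] by (simp add: V[OF x])
      also have "\<dots> \<le> joint_liminf X (\<lambda>\<nu>. Vn \<nu> t) x" by (rule joint_liminf_mono) (simp add: Vn)
      finally show "V t x \<le> joint_liminf X (\<lambda>\<nu>. Vn \<nu> t) x" .
    qed
  qed
  have stages: "stage t" if "t \<in> {1..T + 1}" for t
  proof -
    have "t \<le> T + 1" using that by simp
    then show ?thesis using that
    proof (induction rule: inc_induct)
      case base
      show ?case by (rule last)
    next
      case (step n)
      then show ?case using step.IH \<open>\<And>t. t \<in> {1..T} \<Longrightarrow> stage (t + 1) \<Longrightarrow> stage t\<close>[of n] by simp
    qed
  qed
  show ?thesis
  proof (intro ballI conjI)
    fix t assume "t \<in> {1..T}"
    then have "stage (t + 1)" by (intro stages) simp
    then have S: "\<And>x. x \<in> X \<Longrightarrow> \<bar>V (t + 1) x\<bar> \<noteq> \<infinity>"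
      "pointwise_conv X (\<lambda>\<nu>. Vn \<nu> (t + 1)) (V (t + 1))"
      "\<And>x. x \<in> X \<Longrightarrow> V (t + 1) x \<le> joint_liminf X (\<lambda>\<nu>. Vn \<nu> (t + 1)) x"
      by (auto simp: stage_def)
    show "epi_conv X (\<lambda>\<nu>. Vn \<nu> (t + 1)) (V (t + 1))" using S(3,2) by (rule epi_convI)
    fix x \<xi> assume x: "x \<in> X" "\<xi> \<in> \<Xi>"
    note Yx = Y[OF x, THEN conjunct1] Y[OF x, THEN conjunct2, THEN conjunct1]
      Y[OF x, THEN conjunct2, THEN conjunct2]
    show "LimOut (\<lambda>\<nu>. argmin_on (Y (x, \<xi>)) (bellman_objective (\<phi>n \<nu>) \<beta> (Vn \<nu> (t + 1)) x \<xi>))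
        \<subseteq> argmin_on (Y (x, \<xi>)) (bellman_objective \<phi> \<beta> (V (t + 1)) x \<xi>)"
      using \<open>0 < \<beta>\<close> x Yx epi ptw S by (rule LimOut_argmin_bellman_objective)
    show "argmin_on (Y (x, \<xi>)) (bellman_objective \<phi> \<beta> (V (t + 1)) x \<xi>) \<noteq> {}"
      using \<open>0 < \<beta>\<close> x Yx epi ptw S by (rule argmin_bellman_objective_nonempty)
  qed
qed

end
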